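(* Let $M$ be a finite von Neumann algebra with a normal faithful trace $\tau$. Let $\varphi\in\mathcal B(L^2(M,\tau))^*$ be a regular generating hyperstate, and let $\mathcal B_\varphi$ be the corresponding Poisson boundary. Then $M'\cap\mathcal B_\varphi=\mathcal Z(M)$. In particular, if $\varphi$ is also normal and $M$ is a factor, then $\mathcal B_\varphi$ is also a von Neumann factor.
   Context: $\tau$ is a faithful normal tracial state; $M$ acts on $L^2(M,\tau)$ by left multiplication, $\hat x$ denotes $x\in M$ as a vector, $J\hat x=\widehat{x^*}$, and $\mathcal Z(M)$ is the center of $M$. A hyperstate on $\mathcal B(L^2(M,\tau))$ is a state $\varphi$ with $\varphi|_M=\tau$. Its associated map $\mathcal P_\varphi$ is the unique unital completely positive $M$-bimodular map on $\mathcal B(L^2(M,\tau))$ with $\langle\mathcal P_\varphi(T)\hat y,\hat z\rangle=\varphi(z^*Ty)$ for $y,z\in M$. Put $\mathrm{Har}(\mathcal P_\varphi)=\{T\in\mathcal B(L^2(M,\tau)):\mathcal P_\varphi(T)=T\}$, which contains $M$. $\varphi$ is regular if the restriction of $\mathcal P_\varphi$ to $M'=JMJ$ (which $\mathcal P_\varphi$ maps into itself) preserves the canonical trace $x'\mapsto\langle x'\hat1,\hat1\rangle$ on $M'$. $\varphi$ is generating if $M$ is the largest $*$-subalgebra of $\mathcal B(L^2(M,\tau))$ contained in $\mathrm{Har}(\mathcal P_\varphi)$. The Poisson boundary $\mathcal B_\varphi$ is the $C^*$-algebra (a von Neumann algebra when $\varphi$ is normal) containing $M$, unique up to isomorphism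 fixing $M$, for which there is a completely positive isometric surjection $\mathcal P:\mathcal B_\varphi\to\mathrm{Har}(\mathcal P_\varphi)$ restricting to the identity on $M$ (existence is a theorem of Izumi). $M'\cap\mathcal B_\varphi$ is the relative commutant of $M$ in $\mathcal B_\varphi$. *)

theory Defs
  imports "HOL-Analysis.Analysis"
begin

section \<open>Complex Hilbert spaces and unital \<open>C\<^sup>*\<close>-algebras\<close>

class complex_vector = real_vector +
  fixes scaleC :: "complex \<Rightarrow> 'a \<Rightarrow> 'a"  (infixr \<open>*\<^sub>C\<close> 75)
  assumes scaleC_add_right: "c *\<^sub>C (x + y) = c *\<^sub>C x + c *\<^sub>C y"
    and scaleC_add_left: "(c + d) *\<^sub>C x = c *\<^sub>C x + d *\<^sub>C x"
    and scaleC_scaleC: "c *\<^sub>C d *\<^sub>C x = (c * d) *\<^sub>C x"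
    and scaleC_one: "1 *\<^sub>C x = x"
    and scaleR_scaleC: "r *\<^sub>R x = complex_of_real r *\<^sub>C x"

class complex_normed_vector = complex_vector + real_normed_vector +
  assumes norm_scaleC: "norm (c *\<^sub>C x) = cmod c * norm x"

text \<open>The inner product is linear in the first argument. Hilbert spaces and
  \<open>C\<^sup>*\<close>-algebras are nonzero, so that their operators form an instance of \<^class>\<open>ring_1\<close>; this
  excludes nothing of interest here, as a tracial state takes the value \<open>1\<close> at the unit.\<close>

class complex_hilbert = complex_normed_vector + banach +
  fixes cinner :: "'a \<Rightarrow> 'a \<Rightarrow> complex"
  assumes cinner_commute: "cinner x y = cnj (cinner y x)"
    and cinner_add_left: "cinner (x + y) z = cinner x z + cinner y z"
    and cinner_scaleC_left: "cinner (c *\<^sub>C x) y = c * cinner x y"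
    and cinner_norm: "cinner x x = complex_of_real ((norm x)\<^sup>2)"
    and nonzero: "\<exists>x. x \<noteq> 0"

class star_algebra = ring_1 + complex_vector +
  fixes adj :: "'a \<Rightarrow> 'a"  (\<open>_\<^sup>\<star>\<close> [1000] 999)
  assumes mult_scaleC_left: "(c *\<^sub>C x) * y = c *\<^sub>C (x * y)"
    and mult_scaleC_right: "x * (c *\<^sub>C y) = c *\<^sub>C (x * y)"
    and adj_adj: "(x\<^sup>\<star>)\<^sup>\<star> = x"
    and adj_add: "(x + y)\<^sup>\<star> = x\<^sup>\<star> + y\<^sup>\<star>"
    and adj_scaleC: "(c *\<^sub>C x)\<^sup>\<star> = cnj c *\<^sub>C x\<^sup>\<star>"
    and adj_mult: "(x * y)\<^sup>\<star> = y\<^sup>\<star> * x\<^sup>\<star>"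

class cstar_algebra = star_algebra + real_normed_algebra_1 + complex_normed_vector + banach +
  assumes cstar_identity: "norm (x\<^sup>\<star> * x) = (norm x)\<^sup>2"

definition clinear :: "('a::complex_vector \<Rightarrow> 'b::complex_vector) \<Rightarrow> bool" where
  "clinear f \<longleftrightarrow> (\<forall>x y. f (x + y) = f x + f y) \<and> (\<forall>c x. f (c *\<^sub>C x) = c *\<^sub>C f x)"

instantiation complex :: complex_normed_vector
begin

definition scaleC_complex :: "complex \<Rightarrow> complex \<Rightarrow> complex" where
  "scaleC_complex c z = c * z"

instance
  by standard (auto simp: scaleC_complex_def algebra_simps scaleR_conv_of_real norm_mult)

end

lemma scaleC_zero_right [simp]: "c *\<^sub>C (0::'a::complex_vector) = 0"
  using scaleC_add_right[of c "0::'a" 0] by simp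

lemma scaleC_zero_left [simp]: "0 *\<^sub>C (x::'a::complex_vector) = 0"
  using scaleC_add_left[of 0 0 x] by simp

lemma scaleC_minus_left: "(- c) *\<^sub>C (x::'a::complex_vector) = - (c *\<^sub>C x)"
  using scaleC_add_left[of "- c" c x] by (simp add: eq_neg_iff_add_eq_0)

lemma scaleC_minus_right: "c *\<^sub>C (- x) = - (c *\<^sub>C (x::'a::complex_vector))"
  using scaleC_add_right[of c "- x" x] by (simp add: eq_neg_iff_add_eq_0)

lemma scaleC_diff_right: "c *\<^sub>C (x - y) = c *\<^sub>C x - c *\<^sub>C (y::'a::complex_vector)"
  using scaleC_add_right[of c x "- y"] by (simp add: scaleC_minus_right)

lemma cinner_add_right: "cinner z (x + y) = cinner z x + cinner z (y::'a::complex_hilbert)"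
  by (metis cinner_commute cinner_add_left complex_cnj_add)

lemma cinner_scaleC_right: "cinner x (c *\<^sub>C y) = cnj c * cinner x (y::'a::complex_hilbert)"
  by (metis cinner_commute cinner_scaleC_left complex_cnj_mult)

lemma cinner_zero_left [simp]: "cinner 0 (x::'a::complex_hilbert) = 0"
  using cinner_add_left[of 0 0 x] by simp

lemma cinner_zero_right [simp]: "cinner (x::'a::complex_hilbert) 0 = 0"
  using cinner_add_right[of x 0 0] by simp

lemma cinner_minus_left: "cinner (- x) (y::'a::complex_hilbert) = - cinner x y"
  using cinner_add_left[of "- x" x y] by (simp add: eq_neg_iff_add_eq_0)

lemma cinner_minus_right: "cinner y (- x) = - cinner y (x::'a::complex_hilbert)"
  using cinner_add_right[of y "- x" x] by (simp add: eq_neg_iff_add_eq_0)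

lemma cinner_diff_left: "cinner (x - y) z = cinner x z - cinner y (z::'a::complex_hilbert)"
  using cinner_add_left[of x "- y" z] by (simp add: cinner_minus_left)

lemma cinner_diff_right: "cinner z (x - y) = cinner z x - cinner z (y::'a::complex_hilbert)"
  using cinner_add_right[of z x "- y"] by (simp add: cinner_minus_right)

lemma norm_add_sq:
  fixes x y :: "'a::complex_hilbert"
  shows "(norm (x + y))\<^sup>2 = (norm x)\<^sup>2 + 2 * Re (cinner x y) + (norm y)\<^sup>2"
proof -
  have "complex_of_real ((norm (x + y))\<^sup>2) = cinner (x + y) (x + y)"
    by (simp add: cinner_norm)
  also have "\<dots> = cinner x x + (cinner x y + cnj (cinner x y)) + cinner y y"
    by (simp add: cinner_add_left cinner_add_right flip: cinner_commute[of y x])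
  also have "cinner x y + cnj (cinner x y) = complex_of_real (2 * Re (cinner x y))"
    by (rule complex_add_cnj)
  finally have "complex_of_real ((norm (x + y))\<^sup>2)
      = complex_of_real ((norm x)\<^sup>2 + 2 * Re (cinner x y) + (norm y)\<^sup>2)"
    by (simp add: cinner_norm)
  then show ?thesis
    using of_real_eq_iff by blast
qed

lemma parallelogram_law:
  fixes x y :: "'a::complex_hilbert"
  shows "(norm (x - y))\<^sup>2 = 2 * (norm x)\<^sup>2 + 2 * (norm y)\<^sup>2 - (norm (x + y))\<^sup>2"
  using norm_add_sq[of x y] norm_add_sq[of x "- y"] by (simp add: cinner_minus_right)

lemma cinner_Cauchy_Schwarz:
  fixes x y :: "'a::complex_hilbert"
  shows "cmod (cinner x y) \<le> norm x * norm y"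
proof (cases "y = 0")
  case False
  define t where "t = (norm y)\<^sup>2"
  define c where "c = cinner x y"
  have t: "t > 0" using False by (simp add: t_def)
  define w where "w = x + (- (c / t)) *\<^sub>C y"
  have "0 \<le> (norm w)\<^sup>2" by simp
  also have "(norm w)\<^sup>2 = (norm x)\<^sup>2 + 2 * Re (- cnj (c / t) * c) + (cmod (c / t))\<^sup>2 * t"
    unfolding w_def norm_add_sq
    by (simp add: cinner_scaleC_right norm_scaleC power_mult_distrib t_def c_def)
  also have "- cnj (c / t) * c = complex_of_real (- ((cmod c)\<^sup>2 / t))"
    using t complex_norm_square[of c] by (simp add: field_simps)
  also have "(cmod (c / t))\<^sup>2 * t = (cmod c)\<^sup>2 / t"
    using t by (simp add: norm_divide power2_eq_square field_simps)
  finally have "(cmod c)\<^sup>2 / t \<le> (norm x)\<^sup>2" by simp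
  then have "(cmod c)\<^sup>2 \<le> (norm x * norm y)\<^sup>2"
    using t by (simp add: field_simps t_def power_mult_distrib)
  then show ?thesis
    unfolding c_def by (rule power2_le_imp_le) simp
qed simp

lemma cinner_eqI:
  fixes x y :: "'a::complex_hilbert"
  assumes "\<And>z. cinner z x = cinner z y"
  shows "x = y"
proof -
  have "cinner (x - y) (x - y) = 0"
    using assms[of "x - y"] by (simp add: cinner_diff_right)
  then show ?thesis by (simp add: cinner_norm)
qed

lemma riesz_representation:
  fixes f :: "'a::complex_hilbert \<Rightarrow> complex"
  assumes lin: "clinear f" and bdd: "\<And>x. cmod (f x) \<le> K * norm x"
  shows "\<exists>z. \<forall>x. f x = cinner x z"
proof (cases "\<forall>x. f x = 0")
  case True
  then show ?thesis by (intro exI[of _ 0]) simp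
next
  case False
  have add: "f (x + y) = f x + f y" and sc: "f (c *\<^sub>C x) = c * f x" for x y c
    using lin by (simp_all add: clinear_def scaleC_complex_def)
  have scR: "f (r *\<^sub>R x) = r * f x" for r :: real and x
    by (simp add: scaleR_scaleC sc)
  have blin: "bounded_linear f"
    by (rule bounded_linear_intro[of f K])
      (simp_all add: add scR scaleR_conv_of_real bdd mult.commute)
  obtain u where u: "f u \<noteq> 0" using False by blast
  define S where "S = {x. f x = 1}"
  have Sne: "(1 / f u) *\<^sub>C u \<in> S" using u by (simp add: S_def sc)
  define d where "d = Inf (norm ` S)"
  have bb: "bdd_below (norm ` S)" by (rule bdd_belowI[of _ 0]) auto
  have d_le: "d \<le> norm x" if "x \<in> S" for x
    unfolding d_def using bb that by (intro cInf_lower) auto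
  have d0: "0 \<le> d"
    unfolding d_def using Sne by (intro cInf_greatest) auto
  have "\<exists>x. x \<in> S \<and> norm x < d + 1 / Suc n" for n
  proof -
    have "Inf (norm ` S) < d + 1 / Suc n" by (simp add: d_def)
    then show ?thesis
      using Sne bb by (subst (asm) cInf_less_iff) auto
  qed
  then obtain X where X: "\<And>n. X n \<in> S" "\<And>n. norm (X n) < d + 1 / Suc n" by metis
  have half: "4 * d\<^sup>2 \<le> (norm (x + y))\<^sup>2" if "x \<in> S" "y \<in> S" for x y
  proof -
    have "(1/2) *\<^sub>R (x + y) \<in> S" using that by (simp add: S_def scR add)
    from d_le[OF this] have "2 * d \<le> norm (x + y)" by simp
    then have "(2 * d)\<^sup>2 \<le> (norm (x + y))\<^sup>2" using d0 by (intro power_mono) auto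
    then show ?thesis by (simp add: power_mult_distrib)
  qed
  have lim: "(\<lambda>n. (d + 1 / Suc n)\<^sup>2) \<longlonglongrightarrow> d\<^sup>2"
  proof -
    have "(\<lambda>n. 1 / real (Suc n)) \<longlonglongrightarrow> 0" by (rule LIMSEQ_Suc[OF lim_1_over_n])
    from tendsto_power[OF tendsto_add[OF tendsto_const this], of d 2] show ?thesis by simp
  qed
  have Cau: "Cauchy X"
  proof (rule CauchyI)
    fix e :: real assume e: "0 < e"
    have "\<forall>\<^sub>F n in sequentially. (d + 1 / Suc n)\<^sup>2 < d\<^sup>2 + e\<^sup>2 / 4"
      using lim e by (intro order_tendstoD) auto
    then obtain N where N: "\<And>n. n \<ge> N \<Longrightarrow> (d + 1 / Suc n)\<^sup>2 < d\<^sup>2 + e\<^sup>2 / 4"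
      by (auto simp: eventually_sequentially)
    have nX: "(norm (X n))\<^sup>2 < d\<^sup>2 + e\<^sup>2 / 4" if "n \<ge> N" for n
    proof -
      have "(norm (X n))\<^sup>2 \<le> (d + 1 / Suc n)\<^sup>2"
        using X(2)[of n] by (intro power_mono) auto
      then show ?thesis using N[OF that] by simp
    qed
    have "norm (X m - X n) < e" if "m \<ge> N" "n \<ge> N" for m n
    proof -
      have "(norm (X m - X n))\<^sup>2 < e\<^sup>2"
        using parallelogram_law[of "X m" "X n"] half[OF X(1)[of m] X(1)[of n]]
          nX[OF that(1)] nX[OF that(2)] by simp
      then show ?thesis using e by (rule_tac power2_less_imp_less) auto
    qed
    then show "\<exists>M. \<forall>m\<ge>M. \<forall>n\<ge>M. norm (X m - X n) < e" by blast
  qed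
  then obtain w where w: "X \<longlonglongrightarrow> w"
    using Cauchy_convergent convergent_def by blast
  have "(\<lambda>n. f (X n)) \<longlonglongrightarrow> f w"
    using blin w by (rule bounded_linear.tendsto)
  moreover have "(\<lambda>n. f (X n)) = (\<lambda>n. 1)" using X(1) by (auto simp: S_def)
  ultimately have fw: "f w = 1" by (simp add: LIMSEQ_const_iff)
  have "(norm w)\<^sup>2 \<le> d\<^sup>2"
  proof (rule LIMSEQ_le)
    show "(\<lambda>n. (norm (X n))\<^sup>2) \<longlonglongrightarrow> (norm w)\<^sup>2" using w by (intro tendsto_intros)
    show "\<exists>N. \<forall>n\<ge>N. (norm (X n))\<^sup>2 \<le> (d + 1 / Suc n)\<^sup>2"
      using X(2) by (intro exI[of _ 0] allI impI power_mono) (auto intro: less_imp_le)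
  qed (rule lim)
  then have wmin: "(norm w)\<^sup>2 \<le> (norm x)\<^sup>2" if "x \<in> S" for x
    by (rule order_trans) (rule power_mono[OF d_le[OF that] d0])
  have w0: "w \<noteq> 0" using fw scR[of 0 0] by auto
  have orth: "cinner v w = 0" if v: "f v = 0" for v
  proof (cases "v = 0")
    case False
    define t where "t = (norm v)\<^sup>2"
    define c where "c = cinner w v"
    have t: "t > 0" using False by (simp add: t_def)
    have "w + (- (c / t)) *\<^sub>C v \<in> S" using fw v by (simp add: S_def add sc)
    from wmin[OF this]
    have "0 \<le> 2 * Re (- cnj (c / t) * c) + (cmod (c / t))\<^sup>2 * t"
      unfolding norm_add_sq
      by (simp add: cinner_scaleC_right norm_scaleC power_mult_distrib t_def c_def)
    also have "- cnj (c / t) * c = complex_of_real (- ((cmod c)\<^sup>2 / t))"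
      using t complex_norm_square[of c] by (simp add: field_simps)
    also have "(cmod (c / t))\<^sup>2 * t = (cmod c)\<^sup>2 / t"
      using t by (simp add: norm_divide power2_eq_square field_simps)
    finally have "(cmod c)\<^sup>2 / t \<le> 0" by simp
    then have "c = 0" using t by (simp add: divide_le_0_iff)
    then show ?thesis using cinner_commute[of v w] by (simp add: c_def)
  qed simp
  define s where "s = complex_of_real ((norm w)\<^sup>2)"
  have s: "s \<noteq> 0" using w0 by (simp add: s_def)
  have "f x = cinner x (inverse s *\<^sub>C w)" for x
  proof -
    have "f (x + (- f x) *\<^sub>C w) = 0" by (simp add: add sc fw)
    from orth[OF this] have "cinner x w = f x * s"
      by (simp add: cinner_add_left cinner_scaleC_left cinner_norm s_def)
    moreover have "cnj s = s" by (simp add: s_def)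
    ultimately show ?thesis using s by (simp add: cinner_scaleC_right)
  qed
  then show ?thesis by blast
qed


section \<open>The algebra of bounded operators\<close>

typedef (overloaded) 'h bop =
  "{f :: 'h::complex_hilbert \<Rightarrow>\<^sub>L 'h. \<forall>c x. blinfun_apply f (c *\<^sub>C x) = c *\<^sub>C blinfun_apply f x}"
  morphisms blinfun_of_bop Bop
  by (rule exI[of _ 0]) simp

setup_lifting type_definition_bop

lift_definition bop_apply :: "'h::complex_hilbert bop \<Rightarrow> 'h \<Rightarrow> 'h"  (infixr \<open>\<cdot>\<close> 72)
  is blinfun_apply .

lemma bop_eqI: "(\<And>x. S \<cdot> x = T \<cdot> x) \<Longrightarrow> S = T"
  by transfer (auto intro: blinfun_eqI)

instantiation bop :: (complex_hilbert) "{ring_1, complex_normed_vector, real_normed_algebra_1}"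
begin

lift_definition norm_bop :: "'a bop \<Rightarrow> real" is norm .
lift_definition zero_bop :: "'a bop" is 0 by simp
lift_definition one_bop :: "'a bop" is id_blinfun by simp
lift_definition plus_bop :: "'a bop \<Rightarrow> 'a bop \<Rightarrow> 'a bop" is "(+)"
  by (simp add: plus_blinfun.rep_eq scaleC_add_right)
lift_definition minus_bop :: "'a bop \<Rightarrow> 'a bop \<Rightarrow> 'a bop" is "(-)"
  by (simp add: minus_blinfun.rep_eq scaleC_diff_right)
lift_definition uminus_bop :: "'a bop \<Rightarrow> 'a bop" is uminus
  by (simp add: uminus_blinfun.rep_eq scaleC_minus_right)
lift_definition times_bop :: "'a bop \<Rightarrow> 'a bop \<Rightarrow> 'a bop" is blinfun_compose
  by simp
lift_definition scaleR_bop :: "real \<Rightarrow> 'a bop \<Rightarrow> 'a bop" is scaleR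
  by (simp add: scaleR_blinfun.rep_eq scaleR_scaleC scaleC_scaleC mult.commute)

lemma bounded_linear_scaleC: "bounded_linear (\<lambda>x. c *\<^sub>C blinfun_apply f x)"
  for f :: "'a \<Rightarrow>\<^sub>L 'a"
proof (rule bounded_linear_intro)
  fix x y :: 'a and r :: real
  show "c *\<^sub>C f (x + y) = c *\<^sub>C f x + c *\<^sub>C f y"
    by (simp add: blinfun.add_right scaleC_add_right)
  show "c *\<^sub>C f (r *\<^sub>R x) = r *\<^sub>R c *\<^sub>C f x"
    by (simp only: blinfun.scaleR_right) (simp add: scaleR_scaleC scaleC_scaleC mult.commute)
  show "norm (c *\<^sub>C f x) \<le> norm x * (cmod c * norm f)"
    using mult_left_mono[OF norm_blinfun[of f x], of "cmod c"]
    by (simp add: norm_scaleC mult_ac)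
qed

lift_definition scaleC_bop :: "complex \<Rightarrow> 'a bop \<Rightarrow> 'a bop"
  is "\<lambda>c f. Blinfun (\<lambda>x. c *\<^sub>C blinfun_apply f x)"
  by (simp add: bounded_linear_Blinfun_apply bounded_linear_scaleC scaleC_scaleC mult.commute)

definition dist_bop :: "'a bop \<Rightarrow> 'a bop \<Rightarrow> real" where "dist_bop S T = norm (S - T)"
definition sgn_bop :: "'a bop \<Rightarrow> 'a bop" where "sgn_bop T = inverse (norm T) *\<^sub>R T"
definition uniformity_bop :: "('a bop \<times> 'a bop) filter" where
  "uniformity_bop = (INF e\<in>{0 <..}. principal {(S, T). dist S T < e})"
definition open_bop :: "'a bop set \<Rightarrow> bool" where
  "open_bop U = (\<forall>S\<in>U. \<forall>\<^sub>F (S', T) in uniformity. S' = S \<longrightarrow> T \<in> U)"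

lemma bop_apply_simps [simp]:
  "(0 :: 'a bop) \<cdot> x = 0" "(1 :: 'a bop) \<cdot> x = x"
  "(S + T) \<cdot> x = S \<cdot> x + T \<cdot> x" "(S - T) \<cdot> x = S \<cdot> x - T \<cdot> x" "(- S) \<cdot> x = - (S \<cdot> x)"
  "(S * T) \<cdot> x = S \<cdot> T \<cdot> x" "(r *\<^sub>R S) \<cdot> x = r *\<^sub>R (S \<cdot> x)" "(c *\<^sub>C S) \<cdot> x = c *\<^sub>C (S \<cdot> x)"
  for S T :: "'a bop"
  by (transfer; simp add: plus_blinfun.rep_eq minus_blinfun.rep_eq uminus_blinfun.rep_eq
      scaleR_blinfun.rep_eq bounded_linear_Blinfun_apply bounded_linear_scaleC)+

lemma bop_apply_right:
  "S \<cdot> (x + y) = S \<cdot> x + S \<cdot> y" "S \<cdot> (x - y) = S \<cdot> x - S \<cdot> y" "S \<cdot> (- x) = - (S \<cdot> x)"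
  "S \<cdot> (0::'a) = 0" "S \<cdot> (r *\<^sub>R x) = r *\<^sub>R (S \<cdot> x)" "S \<cdot> (c *\<^sub>C x) = c *\<^sub>C (S \<cdot> x)"
  for S :: "'a bop"
  by (transfer; simp add: blinfun.add_right blinfun.diff_right blinfun.minus_right
      blinfun.scaleR_right)+

lemma norm_bop_apply: "norm (S \<cdot> x) \<le> norm S * norm x" for S :: "'a bop"
  by transfer (rule norm_blinfun)

lemma norm_bop_nonneg: "0 \<le> norm S" for S :: "'a bop"
  by transfer (rule norm_ge_zero)

lemma norm_bop_zero: "norm (0 :: 'a bop) = 0"
  by transfer (rule norm_zero)

lemma norm_bop_bound: "0 \<le> b \<Longrightarrow> (\<And>x. norm (S \<cdot> x) \<le> b * norm x) \<Longrightarrow> norm S \<le> b"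
  for S :: "'a bop"
  by transfer (rule norm_blinfun_bound)

instance
proof
  fix S T U :: "'a bop" and r s :: real and c d :: complex
  show "S + T + U = S + (T + U)" "S + T = T + S" "0 + S = S" "- S + S = 0" "S - T = S + - T"
    by (rule bop_eqI; simp)+
  show "S * T * U = S * (T * U)" "1 * S = S" "S * 1 = S"
    "(S + T) * U = S * U + T * U" "S * (T + U) = S * T + S * U"
    by (rule bop_eqI; simp add: bop_apply_right)+
  show "r *\<^sub>R (S + T) = r *\<^sub>R S + r *\<^sub>R T" "(r + s) *\<^sub>R S = r *\<^sub>R S + s *\<^sub>R S"
    "r *\<^sub>R s *\<^sub>R S = (r * s) *\<^sub>R S" "1 *\<^sub>R S = S"
    by (rule bop_eqI; simp add: algebra_simps)+
  show "r *\<^sub>R S * T = r *\<^sub>R (S * T)" "S * r *\<^sub>R T = r *\<^sub>R (S * T)"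
    by (rule bop_eqI; simp add: bop_apply_right)+
  show "c *\<^sub>C (S + T) = c *\<^sub>C S + c *\<^sub>C T" "(c + d) *\<^sub>C S = c *\<^sub>C S + d *\<^sub>C S"
    "c *\<^sub>C d *\<^sub>C S = (c * d) *\<^sub>C S" "1 *\<^sub>C S = S" "r *\<^sub>R S = complex_of_real r *\<^sub>C S"
    by (rule bop_eqI; simp add: scaleC_add_right scaleC_add_left scaleC_scaleC scaleC_one
        scaleR_scaleC)+
  obtain v :: 'a where v: "v \<noteq> 0" using nonzero by blast
  show "(0 :: 'a bop) \<noteq> 1"
  proof
    assume "(0 :: 'a bop) = 1"
    then have "(0 :: 'a bop) \<cdot> v = (1 :: 'a bop) \<cdot> v" by (rule arg_cong)
    with v show False by simp
  qed
  have "norm (1 :: 'a bop) \<le> 1"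
    by (rule norm_bop_bound) simp_all
  moreover have "1 \<le> norm (1 :: 'a bop)"
    using norm_bop_apply[of 1 v] v by simp
  ultimately show "norm (1 :: 'a bop) = 1" by (rule antisym)
  show "dist S T = norm (S - T)" by (rule dist_bop_def)
  show "sgn S = inverse (norm S) *\<^sub>R S" by (rule sgn_bop_def)
  show "uniformity = (INF e\<in>{0 <..}. principal {(S :: 'a bop, T). dist S T < e})"
    by (rule uniformity_bop_def)
  show "open V = (\<forall>S\<in>V. \<forall>\<^sub>F (S', T) in uniformity. S' = S \<longrightarrow> T \<in> V)" for V :: "'a bop set"
    by (rule open_bop_def)
  show "(norm S = 0) = (S = 0)" by transfer simp
  show "norm (S + T) \<le> norm S + norm T" by transfer (rule norm_triangle_ineq)
  show "norm (r *\<^sub>R S) = \<bar>r\<bar> * norm S" by transfer simp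
  show "norm (S * T) \<le> norm S * norm T" by transfer (rule norm_blinfun_compose)
  have le: "norm (c *\<^sub>C S) \<le> cmod c * norm S" for c and S :: "'a bop"
  proof (rule norm_bop_bound)
    show "norm ((c *\<^sub>C S) \<cdot> x) \<le> cmod c * norm S * norm x" for x
      using mult_left_mono[OF norm_bop_apply[of S x], of "cmod c"]
      by (simp add: norm_scaleC mult_ac)
  qed (simp add: norm_bop_nonneg)
  show "norm (c *\<^sub>C S) = cmod c * norm S"
  proof (cases "c = 0")
    case True
    have "(0::complex) *\<^sub>C S = 0" by (rule bop_eqI) simp
    with True show ?thesis by (simp add: norm_bop_zero)
  next
    case False
    have "S = inverse c *\<^sub>C c *\<^sub>C S"
      by (rule bop_eqI) (simp add: scaleC_scaleC scaleC_one False)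
    then have "norm S \<le> cmod (inverse c) * norm (c *\<^sub>C S)"
      using le[of "inverse c" "c *\<^sub>C S"] by simp
    then have "cmod c * norm S \<le> norm (c *\<^sub>C S)"
      using False by (simp add: norm_inverse norm_divide field_simps)
    with le[of c S] show ?thesis by (rule antisym)
  qed
qed

end

instance bop :: (complex_hilbert) banach
proof
  fix X :: "nat \<Rightarrow> 'a bop"
  assume X: "Cauchy X"
  have nd: "norm (blinfun_of_bop S - blinfun_of_bop T) = norm (S - T)" for S T :: "'a bop"
    by transfer simp
  have "Cauchy (\<lambda>n. blinfun_of_bop (X n))"
    using X by (auto simp: Cauchy_iff nd)
  then obtain F where F: "(\<lambda>n. blinfun_of_bop (X n)) \<longlonglongrightarrow> F"
    using Cauchy_convergent convergent_def by blast
  have ap: "(\<lambda>n. X n \<cdot> x) \<longlonglongrightarrow> blinfun_apply F x" for x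
    using blinfun.tendsto[OF F tendsto_const[of x]] by (simp add: bop_apply.rep_eq)
  have "blinfun_apply F (c *\<^sub>C x) = c *\<^sub>C blinfun_apply F x" for c x
  proof (rule LIMSEQ_unique)
    show "(\<lambda>n. X n \<cdot> (c *\<^sub>C x)) \<longlonglongrightarrow> blinfun_apply F (c *\<^sub>C x)" by (rule ap)
    have "bounded_linear (\<lambda>y::'a. c *\<^sub>C y)"
      using bounded_linear_scaleC[of c id_blinfun] by simp
    from bounded_linear.tendsto[OF this ap[of x]]
    show "(\<lambda>n. X n \<cdot> (c *\<^sub>C x)) \<longlonglongrightarrow> c *\<^sub>C blinfun_apply F x"
      by (simp add: bop_apply_right)
  qed
  then have "blinfun_of_bop (Bop F) = F" by (simp add: Bop_inverse)
  then have "norm (X n - Bop F) = norm (blinfun_of_bop (X n) - F)" for n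
    by (metis nd)
  moreover have "(\<lambda>n. norm (blinfun_of_bop (X n) - F)) \<longlonglongrightarrow> 0"
    using F by (simp add: tendsto_norm_zero_iff LIM_zero_iff)
  ultimately have "(\<lambda>n. norm (X n - Bop F)) \<longlonglongrightarrow> 0" by simp
  then have "X \<longlonglongrightarrow> Bop F"
    by (simp add: tendsto_norm_zero_iff LIM_zero_iff)
  then show "convergent X" by (auto simp: convergent_def)
qed

instantiation bop :: (complex_hilbert) cstar_algebra
begin

definition adj_bop :: "'a bop \<Rightarrow> 'a bop" where
  "adj_bop T = (THE S. \<forall>x y. cinner (T \<cdot> x) y = cinner x (S \<cdot> y))"

lemma cinner_adj_bop: "cinner (T \<cdot> x) y = cinner x (T\<^sup>\<star> \<cdot> y)" for T :: "'a bop"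
proof -
  have "\<exists>z. \<forall>x. cinner (T \<cdot> x) y = cinner x z" for y
  proof (rule riesz_representation)
    show "clinear (\<lambda>x. cinner (T \<cdot> x) y)"
      by (simp add: clinear_def scaleC_complex_def bop_apply_right cinner_add_left
          cinner_scaleC_left)
    show "cmod (cinner (T \<cdot> x) y) \<le> (norm T * norm y) * norm x" for x
      using cinner_Cauchy_Schwarz[of "T \<cdot> x" y]
        mult_right_mono[OF norm_bop_apply[of T x], of "norm y"]
      by (simp add: mult_ac)
  qed
  then obtain A where A: "\<And>x y. cinner (T \<cdot> x) y = cinner x (A y)" by metis
  have Aadd: "A (x + y) = A x + A y" for x y
    by (rule cinner_eqI) (simp add: cinner_add_right flip: A)
  have Asc: "A (c *\<^sub>C x) = c *\<^sub>C A x" for c x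
    by (rule cinner_eqI) (simp add: cinner_scaleC_right flip: A)
  have Abd: "norm (A y) \<le> norm y * norm T" for y
  proof (cases "A y = 0")
    case False
    have "(norm (A y))\<^sup>2 = cmod (cinner (A y) (A y))"
      by (simp add: cinner_norm norm_power)
    also have "\<dots> = cmod (cinner (T \<cdot> A y) y)" by (simp add: A)
    also have "\<dots> \<le> norm (T \<cdot> A y) * norm y" by (rule cinner_Cauchy_Schwarz)
    also have "\<dots> \<le> (norm T * norm (A y)) * norm y"
      by (intro mult_right_mono norm_bop_apply) simp
    finally show ?thesis using False by (simp add: power2_eq_square mult_ac)
  qed simp
  have bl: "bounded_linear A"
    by (rule bounded_linear_intro[of A "norm T"]) (simp_all add: Aadd Asc scaleR_scaleC Abd)
  define S where "S = Bop (Blinfun A)"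
  have S: "S \<cdot> y = A y" for y
    unfolding S_def bop_apply.rep_eq
    by (subst Bop_inverse) (simp_all add: bounded_linear_Blinfun_apply bl Asc)
  have "\<forall>x y. cinner (T \<cdot> x) y = cinner x (T\<^sup>\<star> \<cdot> y)"
    unfolding adj_bop_def
  proof (rule theI)
    show "\<forall>x y. cinner (T \<cdot> x) y = cinner x (S \<cdot> y)" by (simp add: A S)
    show "S' = S" if "\<forall>x y. cinner (T \<cdot> x) y = cinner x (S' \<cdot> y)" for S'
    proof (rule bop_eqI, rule cinner_eqI)
      show "cinner z (S' \<cdot> y) = cinner z (S \<cdot> y)" for y z
        using that A S by metis
    qed
  qed
  then show ?thesis by blast
qed

lemma adj_bop_eqI:
  fixes S T :: "'a bop"
  assumes "\<And>x y. cinner (T \<cdot> x) y = cinner x (S \<cdot> y)"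
  shows "T\<^sup>\<star> = S"
proof (rule bop_eqI, rule cinner_eqI)
  show "cinner z (T\<^sup>\<star> \<cdot> y) = cinner z (S \<cdot> y)" for y z
    using assms[of z y] by (simp only: cinner_adj_bop)
qed

lemma cinner_adj_bop': "cinner (T\<^sup>\<star> \<cdot> x) y = cinner x (T \<cdot> y)" for T :: "'a bop"
  using cinner_adj_bop[of T y x] cinner_commute[of "T\<^sup>\<star> \<cdot> x" y] cinner_commute[of x "T \<cdot> y"]
  by simp

instance
proof
  fix S T :: "'a bop" and c :: complex
  show "c *\<^sub>C S * T = c *\<^sub>C (S * T)" "S * c *\<^sub>C T = c *\<^sub>C (S * T)"
    by (rule bop_eqI; simp add: bop_apply_right)+
  show "(S\<^sup>\<star>)\<^sup>\<star> = S" by (rule adj_bop_eqI) (rule cinner_adj_bop')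
  show "(S + T)\<^sup>\<star> = S\<^sup>\<star> + T\<^sup>\<star>"
    by (rule adj_bop_eqI) (simp add: cinner_add_left cinner_add_right cinner_adj_bop)
  show "(c *\<^sub>C S)\<^sup>\<star> = cnj c *\<^sub>C S\<^sup>\<star>"
    by (rule adj_bop_eqI) (simp add: cinner_scaleC_left cinner_scaleC_right cinner_adj_bop)
  show "(S * T)\<^sup>\<star> = T\<^sup>\<star> * S\<^sup>\<star>"
    by (rule adj_bop_eqI) (simp add: cinner_adj_bop)
  have sq: "(norm T)\<^sup>2 \<le> norm (T\<^sup>\<star> * T)" for T :: "'a bop"
  proof -
    have "norm T \<le> sqrt (norm (T\<^sup>\<star> * T))"
    proof (rule norm_bop_bound)
      fix x
      have "(norm (T \<cdot> x))\<^sup>2 = cmod (cinner (T \<cdot> x) (T \<cdot> x))"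
        by (simp add: cinner_norm norm_power)
      also have "\<dots> = cmod (cinner x ((T\<^sup>\<star> * T) \<cdot> x))" by (simp add: cinner_adj_bop)
      also have "\<dots> \<le> norm x * norm ((T\<^sup>\<star> * T) \<cdot> x)" by (rule cinner_Cauchy_Schwarz)
      also have "\<dots> \<le> norm x * (norm (T\<^sup>\<star> * T) * norm x)"
        by (intro mult_left_mono norm_bop_apply) simp
      also have "\<dots> = (sqrt (norm (T\<^sup>\<star> * T)) * norm x)\<^sup>2"
        by (simp add: power_mult_distrib power2_eq_square)
      finally show "norm (T \<cdot> x) \<le> sqrt (norm (T\<^sup>\<star> * T)) * norm x"
        by (rule power2_le_imp_le) simp
    qed simp
    then have "(norm T)\<^sup>2 \<le> (sqrt (norm (T\<^sup>\<star> * T)))\<^sup>2" by (intro power_mono) auto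
    then show ?thesis by simp
  qed
  have le: "norm T \<le> norm (T\<^sup>\<star>)" for T :: "'a bop"
  proof (cases "T = 0")
    case False
    have "norm T * norm T \<le> norm (T\<^sup>\<star>) * norm T"
      using sq[of T] norm_mult_ineq[of "T\<^sup>\<star>" T] by (simp add: power2_eq_square)
    then show ?thesis using False by simp
  qed simp
  have "norm (S\<^sup>\<star>) = norm S"
    using le[of S] le[of "S\<^sup>\<star>"] \<open>(S\<^sup>\<star>)\<^sup>\<star> = S\<close> by simp
  then have "norm (S\<^sup>\<star> * S) \<le> (norm S)\<^sup>2"
    using norm_mult_ineq[of "S\<^sup>\<star>" S] by (simp add: power2_eq_square)
  with sq[of S] show "norm (S\<^sup>\<star> * S) = (norm S)\<^sup>2" by (intro antisym)
qed

end


section \<open>States, order and complete positivity\<close>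

definition star_le :: "'a::star_algebra \<Rightarrow> 'a \<Rightarrow> bool"  (infix \<open>\<preceq>\<close> 50) where
  "a \<preceq> b \<longleftrightarrow> (\<exists>c. b - a = c\<^sup>\<star> * c)"

definition state :: "('a::star_algebra \<Rightarrow> complex) \<Rightarrow> bool" where
  "state \<phi> \<longleftrightarrow> clinear \<phi> \<and> \<phi> 1 = 1 \<and> (\<forall>a. \<phi> (a\<^sup>\<star> * a) \<in> \<real>\<^sub>\<ge>\<^sub>0)"

definition faithful :: "('a::star_algebra \<Rightarrow> complex) \<Rightarrow> bool" where
  "faithful \<phi> \<longleftrightarrow> (\<forall>a. \<phi> (a\<^sup>\<star> * a) = 0 \<longrightarrow> a = 0)"

definition tracial :: "('a::star_algebra \<Rightarrow> complex) \<Rightarrow> bool" where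
  "tracial \<phi> \<longleftrightarrow> (\<forall>a b. \<phi> (a * b) = \<phi> (b * a))"

text \<open>A state (or positive functional) is normal if it preserves the suprema of increasing nets
  of self-adjoint elements; such nets are given here by upward directed sets.\<close>

definition sa_directed :: "'a::star_algebra set \<Rightarrow> bool" where
  "sa_directed D \<longleftrightarrow> D \<noteq> {} \<and> (\<forall>d\<in>D. d\<^sup>\<star> = d) \<and> (\<forall>d\<in>D. \<forall>e\<in>D. \<exists>f\<in>D. d \<preceq> f \<and> e \<preceq> f)"

definition sa_lub :: "'a::star_algebra set \<Rightarrow> 'a \<Rightarrow> bool" where
  "sa_lub D s \<longleftrightarrow> s\<^sup>\<star> = s \<and> (\<forall>d\<in>D. d \<preceq> s) \<and>
     (\<forall>t. t\<^sup>\<star> = t \<and> (\<forall>d\<in>D. d \<preceq> t) \<longrightarrow> s \<preceq> t)"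

definition normal :: "('a::star_algebra \<Rightarrow> complex) \<Rightarrow> bool" where
  "normal \<phi> \<longleftrightarrow> (\<forall>D s. sa_directed D \<and> sa_lub D s \<longrightarrow> Re (\<phi> s) = (SUP d\<in>D. Re (\<phi> d)))"

text \<open>The amplification to \<open>M\<^sub>n\<close> sends positive matrices to positive matrices,
  a positive element of the \<open>C\<^sup>*\<close>-algebra \<open>M\<^sub>n(A)\<close> being one of the form \<open>X\<^sup>\<star> X\<close>.\<close>

definition completely_positive ::
  "('a::star_algebra \<Rightarrow> 'b::star_algebra) \<Rightarrow> bool" where
  "completely_positive f \<longleftrightarrow> clinear f \<and>
     (\<forall>(n::nat) X. \<exists>Y. \<forall>i<n. \<forall>j<n.
        f (\<Sum>k<n. (X k i)\<^sup>\<star> * X k j) = (\<Sum>k<n. (Y k i)\<^sup>\<star> * Y k j))"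

definition star_hom :: "('a::star_algebra \<Rightarrow> 'b::star_algebra) \<Rightarrow> bool" where
  "star_hom f \<longleftrightarrow> clinear f \<and> f 1 = 1 \<and> (\<forall>a b. f (a * b) = f a * f b) \<and> (\<forall>a. f (a\<^sup>\<star>) = (f a)\<^sup>\<star>)"

definition star_subalgebra :: "'a::star_algebra set \<Rightarrow> bool" where
  "star_subalgebra A \<longleftrightarrow> 0 \<in> A \<and> (\<forall>a\<in>A. \<forall>b\<in>A. a + b \<in> A \<and> a * b \<in> A) \<and>
     (\<forall>a\<in>A. a\<^sup>\<star> \<in> A \<and> (\<forall>c. c *\<^sub>C a \<in> A))"

definition commutant :: "'a::star_algebra set \<Rightarrow> 'a set" where
  "commutant A = {x. \<forall>a\<in>A. x * a = a * x}"

abbreviation center :: "'a::star_algebra set" where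
  "center \<equiv> commutant UNIV"


section \<open>Von Neumann algebras\<close>

text \<open>Von Neumann algebras are taken in the abstract sense, since the Poisson boundary does not
  come with a Hilbert space: they are the \<open>C\<^sup>*\<close>-algebras \<open>A\<close> that are (isometrically) the dual of a
  Banach space (Sakai). Every predual embeds isometrically into the dual of \<open>A\<close>, hence it may be
  taken to be a closed subspace \<open>F\<close> of the space of bounded complex-linear functionals on \<open>A\<close>; the
  duality says that evaluation is an isometry from \<open>A\<close> onto the dual of \<open>F\<close>. The type
  \<open>'a \<Rightarrow>\<^sub>L complex\<close> of the library consists of the real-linear bounded maps.\<close>

definition is_predual :: "('a::cstar_algebra \<Rightarrow>\<^sub>L complex) set \<Rightarrow> bool" where
  "is_predual F \<longleftrightarrow>
     (\<forall>f\<in>F. clinear (blinfun_apply f)) \<and>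
     0 \<in> F \<and> (\<forall>f\<in>F. \<forall>g\<in>F. f + g \<in> F) \<and>
     (\<forall>f\<in>F. \<forall>c. \<exists>g\<in>F. \<forall>a. blinfun_apply g a = c * blinfun_apply f a) \<and>
     closed F \<and>
     (\<forall>a. norm a = (SUP f \<in> {f\<in>F. norm f \<le> 1}. cmod (blinfun_apply f a))) \<and>
     (\<forall>L :: ('a \<Rightarrow>\<^sub>L complex) \<Rightarrow> complex.
        (\<forall>f\<in>F. \<forall>g\<in>F. L (f + g) = L f + L g) \<and>
        (\<forall>f\<in>F. \<forall>g\<in>F. \<forall>c. (\<forall>a. blinfun_apply g a = c * blinfun_apply f a) \<longrightarrow> L g = c * L f) \<and>
        (\<exists>K. \<forall>f\<in>F. cmod (L f) \<le> K * norm f)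
        \<longrightarrow> (\<exists>a. \<forall>f\<in>F. L f = blinfun_apply f a))"

definition von_neumann_algebra :: "'a::cstar_algebra itself \<Rightarrow> bool" where
  "von_neumann_algebra A \<longleftrightarrow> (\<exists>F :: ('a \<Rightarrow>\<^sub>L complex) set. is_predual F)"

definition finite_von_neumann_algebra :: "'a::cstar_algebra itself \<Rightarrow> bool" where
  "finite_von_neumann_algebra A \<longleftrightarrow>
     von_neumann_algebra A \<and> (\<forall>v::'a. v\<^sup>\<star> * v = 1 \<longrightarrow> v * v\<^sup>\<star> = 1)"

definition von_neumann_factor :: "'a::cstar_algebra itself \<Rightarrow> bool" where
  "von_neumann_factor A \<longleftrightarrow>
     von_neumann_algebra A \<and> (center :: 'a set) = range (\<lambda>c. c *\<^sub>C 1)"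


section \<open>Hyperstates and Poisson boundaries\<close>

text \<open>The von Neumann algebra \<open>M\<close> is the type \<open>'m\<close>, and \<open>'h\<close> is a model of \<open>L\<^sup>2(M,\<tau>)\<close>:
  \<open>hat\<close> is the canonical map \<open>M \<rightarrow> L\<^sup>2(M,\<tau>)\<close> into the completion and \<open>lm\<close> is the action of
  \<open>M\<close> on \<open>L\<^sup>2(M,\<tau>)\<close> by left multiplication. As a subset of \<open>\<B>(L\<^sup>2(M,\<tau>))\<close>, the algebra
  \<open>M\<close> is \<open>range lm\<close>.\<close>

definition standard_representation ::
  "('m::cstar_algebra \<Rightarrow> complex) \<Rightarrow> ('m \<Rightarrow> 'h::complex_hilbert) \<Rightarrow> ('m \<Rightarrow> 'h bop) \<Rightarrow> bool" where
  "standard_representation \<tau> hat lm \<longleftrightarrow>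
     clinear hat \<and>
     (\<forall>x y. cinner (hat x) (hat y) = \<tau> (y\<^sup>\<star> * x)) \<and>
     closure (range hat) = UNIV \<and>
     (\<forall>x y. lm x \<cdot> hat y = hat (x * y))"

definition hyperstate ::
  "('m::cstar_algebra \<Rightarrow> complex) \<Rightarrow> ('m \<Rightarrow> 'h::complex_hilbert bop) \<Rightarrow>
    ('h bop \<Rightarrow> complex) \<Rightarrow> bool" where
  "hyperstate \<tau> lm \<phi> \<longleftrightarrow> state \<phi> \<and> (\<forall>x. \<phi> (lm x) = \<tau> x)"

text \<open>\<open>P\<close> is the (unique) map \<open>\<P>\<^sub>\<phi>\<close> associated with the hyperstate \<open>\<phi>\<close>.\<close>

definition associated_map ::
  "('m::cstar_algebra \<Rightarrow> 'h::complex_hilbert) \<Rightarrow> ('m \<Rightarrow> 'h bop) \<Rightarrow> ('h bop \<Rightarrow> complex) \<Rightarrow>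
    ('h bop \<Rightarrow> 'h bop) \<Rightarrow> bool" where
  "associated_map hat lm \<phi> P \<longleftrightarrow>
     completely_positive P \<and> P 1 = 1 \<and>
     (\<forall>x T y. P (lm x * T * lm y) = lm x * P T * lm y) \<and>
     (\<forall>T y z. cinner (P T \<cdot> hat y) (hat z) = \<phi> ((lm z)\<^sup>\<star> * T * lm y))"

definition Har :: "('h::complex_hilbert bop \<Rightarrow> 'h bop) \<Rightarrow> 'h bop set" where
  "Har P = {T. P T = T}"

definition regular ::
  "('m::cstar_algebra \<Rightarrow> 'h::complex_hilbert) \<Rightarrow> ('m \<Rightarrow> 'h bop) \<Rightarrow> ('h bop \<Rightarrow> 'h bop) \<Rightarrow> bool" where
  "regular hat lm P \<longleftrightarrow>
     (\<forall>T \<in> commutant (range lm). cinner (P T \<cdot> hat 1) (hat 1) = cinner (T \<cdot> hat 1) (hat 1))"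

definition generating ::
  "('m::cstar_algebra \<Rightarrow> 'h::complex_hilbert bop) \<Rightarrow> ('h bop \<Rightarrow> 'h bop) \<Rightarrow> bool" where
  "generating lm P \<longleftrightarrow>
     star_subalgebra (range lm) \<and> range lm \<subseteq> Har P \<and>
     (\<forall>A. star_subalgebra A \<and> A \<subseteq> Har P \<longrightarrow> A \<subseteq> range lm)"

text \<open>The \<open>C\<^sup>*\<close>-algebra \<open>'b\<close>, containing \<open>M\<close> through \<open>\<iota>\<close>, is the Poisson boundary; \<open>Q\<close> is the
  Poisson transform, i.e. the completely positive isometric surjection onto \<open>Har P\<close>.\<close>

definition poisson_boundary ::
  "('m::cstar_algebra \<Rightarrow> 'h::complex_hilbert bop) \<Rightarrow> ('h bop \<Rightarrow> 'h bop) \<Rightarrow>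
    ('m \<Rightarrow> 'b::cstar_algebra) \<Rightarrow> ('b \<Rightarrow> 'h bop) \<Rightarrow> bool" where
  "poisson_boundary lm P \<iota> Q \<longleftrightarrow>
     star_hom \<iota> \<and> inj \<iota> \<and>
     completely_positive Q \<and> (\<forall>b. norm (Q b) = norm b) \<and> range Q = Har P \<and>
     (\<forall>x. Q (\<iota> x) = lm x)"

end

theory Submission
  imports Defs
begin

text \<open>A harmonic operator \<open>T\<close> in the commutant \<open>M'\<close> satisfies Schwarz's inequality
  \<open>T\<^sup>\<star> T \<preceq> P (T\<^sup>\<star> T)\<close>. Regularity says that both sides have the same trace, and the trace
  is faithful on \<open>M'\<close> because \<open>hat 1\<close> is separating for it. Hence equality holds, \<open>T\<close> lies in the
  multiplicative domain of \<open>P\<close>, and the harmonic operators in \<open>M'\<close> form a \<open>*\<close>-algebra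
  (\<open>star_subalgebra_Har_commutant\<close>). Since \<open>\<phi>\<close> is generating, this algebra lies in \<open>M\<close>.
  The Poisson transform \<open>Q\<close> is a bimodule map over \<open>M\<close>, again by multiplicative domains, so it
  sends \<open>M' \<inter> \<B>\<^sub>\<phi>\<close> into \<open>M \<inter> M'\<close>; as \<open>Q\<close> is injective and is the identity on \<open>M\<close>,
  the relative commutant is the center of \<open>M\<close>.

  In the normal case the center of the boundary is contained in this relative commutant, so what
  remains is to find a predual. A normal state is a norm limit of finite sums of vector
  functionals \<open>T \<mapsto> \<langle>T u, v\<rangle>\<close> (\<open>normal_state_in_normal_functionals\<close>): it is almost
  carried by a finite-rank projection, since these projections increase to \<open>1\<close>. The harmonic
  operators are therefore the common kernel of a family of such limits (\<open>Har_annihilator\<close>), that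
  is, a weak-\<open>*\<close> closed subspace, and a weak-\<open>*\<close> closed subspace of \<open>\<B>(H)\<close> is the dual of the
  restrictions of the normal functionals
  (\<open>von_neumann_algebra_of_weak_star_closed_range\<close>).\<close>

section \<open>Unital completely positive maps\<close>

lemma adj_zero [simp]: "(0::'a::star_algebra)\<^sup>\<star> = 0"
  using adj_add[of "0::'a" 0] by simp

lemma adj_one [simp]: "(1::'a::star_algebra)\<^sup>\<star> = 1"
  using adj_mult[of "1::'a" "1\<^sup>\<star>"] by (simp add: adj_adj)

lemma adj_minus: "(- x)\<^sup>\<star> = - (x\<^sup>\<star>)" for x :: "'a::star_algebra"
  using adj_add[of "- x" x] by (simp add: eq_neg_iff_add_eq_0)

lemma adj_diff: "(x - y)\<^sup>\<star> = x\<^sup>\<star> - y\<^sup>\<star>" for x :: "'a::star_algebra"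
  using adj_add[of x "- y"] by (simp add: adj_minus)

lemma adj_sum: "(sum f A)\<^sup>\<star> = (\<Sum>i\<in>A. (f i :: 'a::star_algebra)\<^sup>\<star>)"
  by (induction A rule: infinite_finite_induct) (simp_all add: adj_add)

text \<open>A row \<open>(a 0, \<dots>, a (n - 1))\<close>, padded with zero rows, is a square matrix whose \<open>X\<^sup>\<star> X\<close> is the
  Gram matrix of the \<open>a i\<close>.\<close>

lemma completely_positive_gram:
  fixes f :: "'a::star_algebra \<Rightarrow> 'b::star_algebra" and a :: "nat \<Rightarrow> 'a"
  assumes "completely_positive f"
  obtains Y where "\<And>i j. i < n \<Longrightarrow> j < n \<Longrightarrow> f ((a i)\<^sup>\<star> * a j) = (\<Sum>k<n. (Y k i)\<^sup>\<star> * Y k j)"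
proof -
  define X where "X k i = (if k = 0 then a i else 0)" for k i :: nat
  have "\<exists>Y. \<forall>i<n. \<forall>j<n.
      f (\<Sum>k<n. (X k i)\<^sup>\<star> * X k j) = (\<Sum>k<n. (Y k i)\<^sup>\<star> * Y k j)"
    using assms unfolding completely_positive_def by (elim conjE allE)
  then obtain Y where Y: "\<forall>i<n. \<forall>j<n.
      f (\<Sum>k<n. (X k i)\<^sup>\<star> * X k j) = (\<Sum>k<n. (Y k i)\<^sup>\<star> * Y k j)" ..
  have X: "(\<Sum>k<n. (X k i)\<^sup>\<star> * X k j) = (a i)\<^sup>\<star> * a j" if "i < n" for i j
  proof -
    have "(\<Sum>k<n. (X k i)\<^sup>\<star> * X k j) = (\<Sum>k<n. if k = 0 then (a i)\<^sup>\<star> * a j else 0)"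
      by (rule sum.cong) (auto simp: X_def)
    then show ?thesis using that by simp
  qed
  have "f ((a i)\<^sup>\<star> * a j) = (\<Sum>k<n. (Y k i)\<^sup>\<star> * Y k j)" if "i < n" "j < n" for i j
  proof -
    have "f (\<Sum>k<n. (X k i)\<^sup>\<star> * X k j) = (\<Sum>k<n. (Y k i)\<^sup>\<star> * Y k j)"
      using Y that by blast
    then show ?thesis by (simp only: X[OF that(1)])
  qed
  then show thesis by (rule that)
qed

lemma completely_positive_adj:
  fixes f :: "'a::star_algebra \<Rightarrow> 'b::star_algebra"
  assumes "completely_positive f"
  shows "f (x\<^sup>\<star>) = (f x)\<^sup>\<star>"
proof -
  define a where "a i = (if i = 0 then 1 else x)" for i :: nat
  obtain Y where Y: "\<And>i j. i < 2 \<Longrightarrow> j < 2 \<Longrightarrow>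
      f ((a i)\<^sup>\<star> * a j) = (\<Sum>k<(2::nat). (Y k i)\<^sup>\<star> * Y k j)"
    by (rule completely_positive_gram[OF assms, of 2 a]) blast
  show ?thesis
    using Y[of 0 1] Y[of 1 0] by (simp add: a_def adj_sum adj_mult adj_adj)
qed

text \<open>Schwarz's inequality in matrix form. In the Gram matrix of \<open>1, x 0, x 1, \<dots>\<close> the first column
  of the factor \<open>Y\<close> satisfies \<open>\<Sum> (Y k 0)\<^sup>\<star> Y k 0 = 1\<close>; subtracting from each other column its
  component along the first one leaves the defect as a Gram matrix.\<close>

lemma schwarz_defect:
  fixes f :: "'a::star_algebra \<Rightarrow> 'b::star_algebra" and x :: "nat \<Rightarrow> 'a"
  assumes cp: "completely_positive f" and one: "f 1 = 1"
  obtains Z where "\<And>i j. i < n \<Longrightarrow> j < n \<Longrightarrow>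
    f ((x i)\<^sup>\<star> * x j) - (f (x i))\<^sup>\<star> * f (x j) = (\<Sum>k<Suc n. (Z k i)\<^sup>\<star> * Z k j)"
proof -
  define a where "a i = (case i of 0 \<Rightarrow> 1 | Suc m \<Rightarrow> x m)" for i
  obtain Y where Y: "\<And>i j. i < Suc n \<Longrightarrow> j < Suc n \<Longrightarrow>
      f ((a i)\<^sup>\<star> * a j) = (\<Sum>k<Suc n. (Y k i)\<^sup>\<star> * Y k j)"
    by (rule completely_positive_gram[OF cp, of "Suc n" a]) blast
  define Z where "Z k i = Y k (Suc i) - Y k 0 * f (x i)" for k i
  have "f ((x i)\<^sup>\<star> * x j) - (f (x i))\<^sup>\<star> * f (x j) = (\<Sum>k<Suc n. (Z k i)\<^sup>\<star> * Z k j)"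
    if "i < n" "j < n" for i j
  proof -
    have G: "(\<Sum>k<Suc n. (Y k 0)\<^sup>\<star> * Y k 0) = 1"
      "(\<Sum>k<Suc n. (Y k (Suc i))\<^sup>\<star> * Y k 0) = (f (x i))\<^sup>\<star>"
      "(\<Sum>k<Suc n. (Y k 0)\<^sup>\<star> * Y k (Suc j)) = f (x j)"
      "(\<Sum>k<Suc n. (Y k (Suc i))\<^sup>\<star> * Y k (Suc j)) = f ((x i)\<^sup>\<star> * x j)"
      using Y[of 0 0] Y[of "Suc i" 0] Y[of 0 "Suc j"] Y[of "Suc i" "Suc j"] that
      by (simp_all add: a_def one completely_positive_adj[OF cp])
    have "(\<Sum>k<Suc n. (Z k i)\<^sup>\<star> * Z k j)
      = (\<Sum>k<Suc n. (Y k (Suc i))\<^sup>\<star> * Y k (Suc j)) - (\<Sum>k<Suc n. (Y k (Suc i))\<^sup>\<star> * Y k 0) * f (x j)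
        - (f (x i))\<^sup>\<star> * (\<Sum>k<Suc n. (Y k 0)\<^sup>\<star> * Y k (Suc j))
        + (f (x i))\<^sup>\<star> * (\<Sum>k<Suc n. (Y k 0)\<^sup>\<star> * Y k 0) * f (x j)"
      unfolding Z_def sum_distrib_left sum_distrib_right sum_subtractf[symmetric]
        sum.distrib[symmetric]
      by (rule sum.cong) (simp_all add: adj_diff adj_mult algebra_simps)
    then show ?thesis unfolding G by simp
  qed
  then show thesis by (rule that)
qed

lemma bop_apply_sum: "(\<Sum>i\<in>A. T i) \<cdot> v = (\<Sum>i\<in>A. T i \<cdot> v)"
  by (induction A rule: infinite_finite_induct) simp_all

lemma cinner_sum_left: "cinner (\<Sum>i\<in>A. x i) y = (\<Sum>i\<in>A. cinner (x i) y)"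
  by (induction A rule: infinite_finite_induct) (simp_all add: cinner_add_left)

lemma sum_adj_mult_kernel:
  fixes Z :: "nat \<Rightarrow> 'h::complex_hilbert bop"
  assumes "cinner ((\<Sum>k<n. (Z k)\<^sup>\<star> * Z k) \<cdot> v) v = 0" and "k < n"
  shows "Z k \<cdot> v = 0"
proof -
  have "complex_of_real (\<Sum>k<n. (norm (Z k \<cdot> v))\<^sup>2) = 0"
    using assms(1) by (simp add: bop_apply_sum cinner_sum_left cinner_adj_bop' cinner_norm)
  then have "(\<Sum>k<n. (norm (Z k \<cdot> v))\<^sup>2) = 0"
    using of_real_eq_0_iff by blast
  then have "\<forall>k<n. (norm (Z k \<cdot> v))\<^sup>2 = 0"
    by (subst (asm) sum_nonneg_eq_0_iff) auto
  with assms(2) show ?thesis by simp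
qed

text \<open>If the defect of \<open>x\<close> with itself vanishes, then so does the corresponding column of the factor
  \<open>Z\<close>, and with it the defect of \<open>x\<close> with every \<open>y\<close>.\<close>

lemma multiplicative_domain:
  fixes f :: "'a::star_algebra \<Rightarrow> 'h::complex_hilbert bop"
  assumes cp: "completely_positive f" and one: "f 1 = 1"
    and x: "f (x\<^sup>\<star> * x) = (f x)\<^sup>\<star> * f x"
  shows "f (x\<^sup>\<star> * y) = (f x)\<^sup>\<star> * f y"
proof -
  define a where "a i = (if i = 0 then x else y)" for i :: nat
  obtain Z where Z: "\<And>i j. i < 2 \<Longrightarrow> j < 2 \<Longrightarrow>
      f ((a i)\<^sup>\<star> * a j) - (f (a i))\<^sup>\<star> * f (a j) = (\<Sum>k<Suc 2. (Z k i)\<^sup>\<star> * Z k j)"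
    by (rule schwarz_defect[OF cp one, of 2 a]) blast
  have "(\<Sum>k<Suc 2. (Z k 0)\<^sup>\<star> * Z k 0) = 0"
    using Z[of 0 0] x by (simp add: a_def)
  then have "Z k 0 \<cdot> v = 0" if "k < Suc 2" for k v
    using that by (intro sum_adj_mult_kernel[of "\<lambda>k. Z k 0" "Suc 2" v k]) simp_all
  then have Z0: "Z k 0 = 0" if "k < Suc 2" for k
    using that by (intro bop_eqI) simp
  have "(\<Sum>k<Suc 2. (Z k 0)\<^sup>\<star> * Z k 1) = 0"
    by (rule sum.neutral) (use Z0 in auto)
  with Z[of 0 1] show ?thesis by (simp add: a_def)
qed


section \<open>Positive operators and their square roots\<close>

lemma semi_inner_Cauchy_Schwarz:
  fixes s :: "'a::complex_vector \<Rightarrow> 'a \<Rightarrow> complex"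
  assumes add: "\<And>x y z. s (x + y) z = s x z + s y z"
    and sc: "\<And>c x y. s (c *\<^sub>C x) y = c * s x y"
    and herm: "\<And>x y. s x y = cnj (s y x)"
    and pos: "\<And>x. 0 \<le> Re (s x x)"
  shows "(cmod (s x y))\<^sup>2 \<le> Re (s x x) * Re (s y y)"
proof -
  have addr: "s z (x + y) = s z x + s z y" for x y z
    by (subst (1 2 3) herm) (simp add: add)
  have scr: "s x (c *\<^sub>C y) = cnj c * s x y" for c x y
    by (subst (1 2) herm) (simp add: sc)
  define b where "b = s x y"
  have yx: "s y x = cnj b" unfolding b_def by (rule herm)
  have key: "0 \<le> Re (s x x) - 2 * t * (cmod b)\<^sup>2 + t\<^sup>2 * (cmod b)\<^sup>2 * Re (s y y)" for t :: real
  proof -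
    define c where "c = - (complex_of_real t * b)"
    have "Re (s (x + c *\<^sub>C y) (x + c *\<^sub>C y)) =
      Re (s x x) + Re (cnj c * b) + Re (c * cnj b) + Re (c * cnj c * s y y)"
      by (simp add: add addr sc scr yx b_def[symmetric] algebra_simps)
    moreover have "Re (cnj c * b) = - t * (cmod b)\<^sup>2" "Re (c * cnj b) = - t * (cmod b)\<^sup>2"
      unfolding cmod_power2 c_def by (simp_all add: power2_eq_square algebra_simps)
    moreover have "c * cnj c = complex_of_real (t\<^sup>2 * (cmod b)\<^sup>2)"
      using complex_norm_square[of c] by (simp add: c_def norm_mult power_mult_distrib)
    then have "Re (c * cnj c * s y y) = t\<^sup>2 * (cmod b)\<^sup>2 * Re (s y y)"
      by simp
    ultimately show ?thesis using pos[of "x + c *\<^sub>C y"] by linarith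
  qed
  show ?thesis
  proof (cases "Re (s y y) = 0")
    case True
    have "b = 0"
    proof (rule ccontr)
      assume "b \<noteq> 0"
      then have "(cmod b)\<^sup>2 > 0" by simp
      \<comment> \<open>This value of \<open>t\<close> turns the right-hand side of \<open>key\<close> into \<open>- 1\<close>.\<close>
      with key[of "(Re (s x x) + 1) / (2 * (cmod b)\<^sup>2)"] True show False
        by simp
    qed
    with True show ?thesis by (simp add: b_def)
  next
    case False
    then have p: "Re (s y y) > 0" using pos[of y] by simp
    \<comment> \<open>The quadratic polynomial in \<open>t\<close> is smallest at this point.\<close>
    from key[of "1 / Re (s y y)"] have "0 \<le> Re (s x x) - (cmod b)\<^sup>2 / Re (s y y)"
      using p by (simp add: power2_eq_square)
    then show ?thesis using p by (simp add: field_simps b_def)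
  qed
qed

definition positive_bop :: "'h::complex_hilbert bop \<Rightarrow> bool" where
  "positive_bop A \<longleftrightarrow> A\<^sup>\<star> = A \<and> (\<forall>x. 0 \<le> Re (cinner (A \<cdot> x) x))"

lemma positive_contraction:
  assumes "positive_bop A" and "positive_bop (1 - A)"
  shows "norm A \<le> 1"
proof (rule norm_bop_bound)
  fix x
  define y where "y = A \<cdot> x"
  have sa: "A\<^sup>\<star> = A" and pos: "0 \<le> Re (cinner (A \<cdot> z) z)" for z
    using assms(1) by (auto simp: positive_bop_def)
  have le: "Re (cinner (A \<cdot> z) z) \<le> (norm z)\<^sup>2" for z
  proof -
    have "0 \<le> Re (cinner ((1 - A) \<cdot> z) z)" using assms(2) by (simp only: positive_bop_def)
    then show ?thesis by (simp add: cinner_diff_left cinner_norm)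
  qed
  have "(cmod (cinner (A \<cdot> x) y))\<^sup>2 \<le> Re (cinner (A \<cdot> x) x) * Re (cinner (A \<cdot> y) y)"
  proof (rule semi_inner_Cauchy_Schwarz[of "\<lambda>x y. cinner (A \<cdot> x) y"])
    show "cinner (A \<cdot> x) y = cnj (cinner (A \<cdot> y) x)" for x y
      by (metis cinner_adj_bop cinner_commute sa)
  qed (simp_all add: bop_apply_right cinner_add_left cinner_scaleC_left pos)
  also have "\<dots> \<le> (norm x)\<^sup>2 * (norm y)\<^sup>2"
    by (intro mult_mono le pos) simp
  finally have "(norm y * norm y)\<^sup>2 \<le> (norm x * norm y)\<^sup>2"
    by (simp add: y_def[symmetric] cinner_norm norm_mult power2_eq_square mult_ac)
  then have "norm y * norm y \<le> norm x * norm y" by (rule power2_le_imp_le) simp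
  then show "norm (A \<cdot> x) \<le> 1 * norm x"
    by (cases "norm y = 0") (auto simp: y_def[symmetric])
qed simp

lemma norm_adj [simp]: "norm (x\<^sup>\<star>) = norm x" for x :: "'a::cstar_algebra"
proof -
  have le: "norm y \<le> norm (y\<^sup>\<star>)" for y :: 'a
  proof (cases "y = 0")
    case False
    have "norm y * norm y \<le> norm (y\<^sup>\<star>) * norm y"
      using cstar_identity[of y] norm_mult_ineq[of "y\<^sup>\<star>" y] by (simp add: power2_eq_square)
    with False show ?thesis by simp
  qed simp
  from le[of x] le[of "x\<^sup>\<star>"] show ?thesis by (simp add: adj_adj)
qed

lemma adj_scaleR: "(r *\<^sub>R x)\<^sup>\<star> = r *\<^sub>R x\<^sup>\<star>" for x :: "'a::star_algebra"
  by (simp add: scaleR_scaleC adj_scaleC)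

lemma bounded_linear_adj: "bounded_linear (adj :: 'a::cstar_algebra \<Rightarrow> 'a)"
  by (rule bounded_linear_intro[of _ 1]) (simp_all add: adj_add adj_scaleR)

text \<open>The fixed points of this iteration are the solutions of \<open>(1 - y)\<^sup>2 = 1 - b\<close>.\<close>

fun sqrt_iter :: "'a::real_algebra_1 \<Rightarrow> nat \<Rightarrow> 'a" where
  "sqrt_iter b 0 = 0"
| "sqrt_iter b (Suc n) = (1/2) *\<^sub>R (b + sqrt_iter b n * sqrt_iter b n)"

text \<open>As polynomials in \<open>b\<close>, the iterates and their increments have nonnegative coefficients. Hence for
  \<open>norm b \<le> 1\<close> the increments are dominated by those of the scalar iteration at \<open>b = 1\<close>, which
  is increasing and bounded by \<open>1\<close>, and the iteration converges in norm.\<close>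

lemma sqrt_one_minus:
  fixes b :: "'a::cstar_algebra"
  assumes nb: "norm b \<le> 1" and sa: "b\<^sup>\<star> = b"
  shows "\<exists>c. c\<^sup>\<star> = c \<and> c * c = 1 - b"
proof -
  define Y where "Y = sqrt_iter b"
  define y :: "nat \<Rightarrow> real" where "y = sqrt_iter 1"
  have y01: "0 \<le> y n \<and> y n \<le> 1" for n
  proof (induction n)
    case (Suc n)
    then have "y n * y n \<le> 1" by (simp add: mult_le_one)
    then show ?case using Suc by (simp add: y_def)
  qed (simp add: y_def)
  have Yy: "norm (Y n) \<le> y n" for n
  proof (induction n)
    case (Suc n)
    have "norm (b + Y n * Y n) \<le> norm b + norm (Y n) * norm (Y n)"
      by (meson norm_triangle_ineq norm_mult_ineq add_left_mono order_trans)
    also have "\<dots> \<le> 1 + y n * y n"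
      using nb Suc by (intro add_mono mult_mono) (auto simp: y01)
    finally show ?case by (simp add: Y_def y_def)
  qed (simp add: Y_def y_def)
  have step: "norm (Y (Suc n) - Y n) \<le> y (Suc n) - y n" for n
  proof (induction n)
    case 0
    show ?case using nb by (simp add: Y_def y_def)
  next
    case (Suc n)
    let ?D = "Y (Suc n) - Y n" and ?d = "y (Suc n) - y n"
    have d: "0 \<le> ?d" using order_trans[OF norm_ge_zero Suc] .
    have "Y (Suc (Suc n)) - Y (Suc n) = (1/2) *\<^sub>R (Y (Suc n) * ?D + ?D * Y n)"
    proof -
      have "Y (Suc (Suc n)) - Y (Suc n)
        = (1/2) *\<^sub>R (b + Y (Suc n) * Y (Suc n)) - (1/2) *\<^sub>R (b + Y n * Y n)"
        by (simp add: Y_def)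
      also have "\<dots> = (1/2) *\<^sub>R (Y (Suc n) * ?D + ?D * Y n)"
        unfolding scaleR_diff_right[symmetric] by (simp add: algebra_simps)
      finally show ?thesis .
    qed
    moreover have "norm (Y (Suc n) * ?D + ?D * Y n) \<le> y (Suc n) * ?d + ?d * y n"
    proof -
      have "norm (Y (Suc n) * ?D + ?D * Y n) \<le> norm (Y (Suc n)) * norm ?D + norm ?D * norm (Y n)"
        by (meson norm_triangle_ineq norm_mult_ineq add_mono order_trans)
      also have "\<dots> \<le> y (Suc n) * ?d + ?d * y n"
        using Suc Yy y01 d by (intro add_mono mult_mono) (auto intro: order_trans[OF norm_ge_zero])
      finally show ?thesis .
    qed
    ultimately have "norm (Y (Suc (Suc n)) - Y (Suc n)) \<le> (1/2) * (y (Suc n) * ?d + ?d * y n)"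
      by simp
    also have "\<dots> = (1/2) * (1 + y (Suc n) * y (Suc n)) - (1/2) * (1 + y n * y n)"
      by (simp add: algebra_simps)
    also have "\<dots> = y (Suc (Suc n)) - y (Suc n)" by (simp add: y_def)
    finally show ?case .
  qed
  have "y n \<le> y (Suc n)" for n
    using step[of n] norm_ge_zero[of "Y (Suc n) - Y n"] by linarith
  then have "incseq y" by (rule incseq_SucI)
  then have "convergent y"
    using y01 by (intro Bseq_mono_convergent BseqI'[of _ 1]) (auto simp: incseq_def)
  then have cau: "Cauchy y" by (rule convergent_Cauchy)
  have tele: "norm (Y (n + k) - Y n) \<le> y (n + k) - y n" for n k
  proof (induction k)
    case (Suc k)
    have "norm (Y (n + Suc k) - Y n) \<le> norm (Y (Suc (n + k)) - Y (n + k)) + norm (Y (n + k) - Y n)"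
      using norm_triangle_ineq[of "Y (Suc (n + k)) - Y (n + k)" "Y (n + k) - Y n"] by simp
    also have "\<dots> \<le> y (n + Suc k) - y n" using Suc step[of "n + k"] by simp
    finally show ?case .
  qed simp
  have tele': "norm (Y m - Y n) \<le> \<bar>y m - y n\<bar>" for m n
  proof (cases "n \<le> m")
    case True
    then show ?thesis using tele[of n "m - n"] by simp
  next
    case False
    then show ?thesis using tele[of m "n - m"] by (simp add: norm_minus_commute)
  qed
  have "Cauchy Y"
  proof (rule CauchyI)
    fix e :: real assume "0 < e"
    with cau obtain M where "\<forall>m\<ge>M. \<forall>n\<ge>M. norm (y m - y n) < e"
      by (meson CauchyD)
    then show "\<exists>M. \<forall>m\<ge>M. \<forall>n\<ge>M. norm (Y m - Y n) < e"
      using tele' by (metis order_le_less_trans real_norm_def)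
  qed
  then obtain L where L: "Y \<longlonglongrightarrow> L" using Cauchy_convergent convergent_def by blast
  have "(\<lambda>n. Y (Suc n)) \<longlonglongrightarrow> L" using L by (rule LIMSEQ_Suc)
  moreover have "(\<lambda>n. Y (Suc n)) \<longlonglongrightarrow> (1/2) *\<^sub>R (b + L * L)"
    unfolding Y_def sqrt_iter.simps by (intro tendsto_intros) (use L in \<open>simp_all add: Y_def\<close>)
  ultimately have "L = (1/2) *\<^sub>R (b + L * L)" by (rule LIMSEQ_unique)
  then have "2 *\<^sub>R L = 2 *\<^sub>R (1/2) *\<^sub>R (b + L * L)" by simp
  then have LL: "L + L = b + L * L" by (simp add: scaleR_2)
  have "(Y n)\<^sup>\<star> = Y n" for n
    by (induction n) (simp_all add: Y_def adj_scaleR adj_add adj_mult sa)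
  then have "Y \<longlonglongrightarrow> L\<^sup>\<star>"
    using bounded_linear.tendsto[OF bounded_linear_adj L] by simp
  with L have "L\<^sup>\<star> = L" by (metis LIMSEQ_unique)
  moreover have "(1 - L) * (1 - L) = 1 - b"
    using LL by (simp add: algebra_simps)
  ultimately show ?thesis
    by (intro exI[of _ "1 - L"]) (simp add: adj_diff)
qed

text \<open>After scaling, \<open>0 \<le> A \<le> 1\<close> as a form, so that \<open>1 - A\<close> is a contraction and has the square root
  required. This connects positivity of the quadratic form with the algebraic order \<open>\<preceq>\<close>.\<close>

lemma positive_bop_factor:
  assumes "positive_bop A"
  shows "\<exists>c. A = c\<^sup>\<star> * c"
proof (cases "A = 0")
  case True
  then show ?thesis by (intro exI[of _ 0]) simp
next
  case False
  define r where "r = norm A"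
  have r: "r > 0" using False by (simp add: r_def)
  define B where "B = 1 - (1/r) *\<^sub>R A"
  have sa: "A\<^sup>\<star> = A" and pos: "0 \<le> Re (cinner (A \<cdot> x) x)" for x
    using assms by (auto simp: positive_bop_def)
  have scR: "cinner (t *\<^sub>R x) y = complex_of_real t * cinner x y" for t and x y :: 'a
    by (simp add: scaleR_scaleC cinner_scaleC_left)
  have Bsa: "B\<^sup>\<star> = B" by (simp add: B_def adj_diff adj_scaleR sa)
  have "positive_bop (1 - B)"
    using r pos by (simp add: positive_bop_def B_def adj_scaleR sa scR)
  moreover have "positive_bop B"
    unfolding positive_bop_def
  proof (intro conjI allI)
    fix x
    have "Re (cinner (A \<cdot> x) x) \<le> cmod (cinner (A \<cdot> x) x)" by (rule complex_Re_le_cmod)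
    also have "\<dots> \<le> norm (A \<cdot> x) * norm x" by (rule cinner_Cauchy_Schwarz)
    also have "\<dots> \<le> r * norm x * norm x"
      unfolding r_def by (intro mult_right_mono norm_bop_apply) simp
    finally have "Re (cinner (A \<cdot> x) x) / r \<le> (norm x)\<^sup>2"
      using r by (simp add: field_simps power2_eq_square)
    then show "0 \<le> Re (cinner (B \<cdot> x) x)"
      by (simp add: B_def cinner_diff_left scR cinner_norm)
  qed (rule Bsa)
  ultimately have "norm B \<le> 1" by (intro positive_contraction)
  then obtain c where c: "c\<^sup>\<star> = c" "c * c = 1 - B" using sqrt_one_minus Bsa by blast
  have "(sqrt r *\<^sub>R c)\<^sup>\<star> * (sqrt r *\<^sub>R c) = A"
    using r c by (simp add: adj_scaleR B_def)
  then show ?thesis by metis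
qed


section \<open>States on the bounded operators\<close>

lemma state_add: "state \<phi> \<Longrightarrow> \<phi> (a + b) = \<phi> a + \<phi> b"
  and state_scaleC: "state \<phi> \<Longrightarrow> \<phi> (c *\<^sub>C a) = c * \<phi> a"
  and state_one: "state \<phi> \<Longrightarrow> \<phi> 1 = 1"
  by (simp_all add: state_def clinear_def scaleC_complex_def)

lemma state_diff: "state \<phi> \<Longrightarrow> \<phi> (a - b) = \<phi> a - \<phi> b"
  using state_add[of \<phi> "a - b" b] by simp

lemma state_pos:
  assumes "state \<phi>"
  shows "0 \<le> Re (\<phi> (a\<^sup>\<star> * a))" and "Im (\<phi> (a\<^sup>\<star> * a)) = 0"
  using assms by (auto simp: state_def complex_nonneg_Reals_iff)

lemma state_adj:
  assumes "state \<phi>"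
  shows "\<phi> (a\<^sup>\<star>) = cnj (\<phi> a)"
proof -
  have ex: "\<phi> ((1 + c *\<^sub>C a)\<^sup>\<star> * (1 + c *\<^sub>C a)) =
      1 + c * \<phi> a + cnj c * \<phi> (a\<^sup>\<star>) + cnj c * (c * \<phi> (a\<^sup>\<star> * a))" for c
    using assms
    by (simp add: adj_add adj_scaleC algebra_simps mult_scaleC_left mult_scaleC_right
        state_add state_scaleC state_one)
  have im: "Im (1 + c * \<phi> a + cnj c * \<phi> (a\<^sup>\<star>) + cnj c * (c * \<phi> (a\<^sup>\<star> * a))) = 0" for c
    using state_pos(2)[OF assms, of "1 + c *\<^sub>C a"] unfolding ex .
  \<comment> \<open>The values \<open>c = 1\<close> and \<open>c = \<i>\<close> determine the imaginary and the real part.\<close>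
  show ?thesis
    using im[of 1] im[of \<i>] state_pos(2)[OF assms, of a] by (simp add: complex_eq_iff)
qed

lemma state_Cauchy_Schwarz:
  assumes "state \<phi>"
  shows "(cmod (\<phi> (b\<^sup>\<star> * a)))\<^sup>2 \<le> Re (\<phi> (a\<^sup>\<star> * a)) * Re (\<phi> (b\<^sup>\<star> * b))"
proof (rule semi_inner_Cauchy_Schwarz[of "\<lambda>a b. \<phi> (b\<^sup>\<star> * a)"])
  show "\<phi> (y\<^sup>\<star> * x) = cnj (\<phi> (x\<^sup>\<star> * y))" for x y
    using state_adj[OF assms, of "x\<^sup>\<star> * y"] by (simp add: adj_mult adj_adj)
qed (simp_all add: assms distrib_left state_add state_scaleC mult_scaleC_right state_pos)

lemma state_square_le:
  fixes \<phi> :: "'h::complex_hilbert bop \<Rightarrow> complex"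
  assumes "state \<phi>"
  shows "Re (\<phi> (T\<^sup>\<star> * T)) \<le> (norm T)\<^sup>2"
proof -
  let ?r = "complex_of_real ((norm T)\<^sup>2)"
  have "positive_bop (?r *\<^sub>C 1 - T\<^sup>\<star> * T)"
    unfolding positive_bop_def
  proof (intro conjI allI)
    show "(?r *\<^sub>C 1 - T\<^sup>\<star> * T)\<^sup>\<star> = ?r *\<^sub>C 1 - T\<^sup>\<star> * T"
      by (simp add: adj_diff adj_scaleC adj_mult adj_adj)
    fix x
    have "(norm (T \<cdot> x))\<^sup>2 \<le> (norm T)\<^sup>2 * (norm x)\<^sup>2"
      using power_mono[OF norm_bop_apply[of T x], of 2] by (simp add: power_mult_distrib)
    moreover have "cinner ((?r *\<^sub>C 1 - T\<^sup>\<star> * T) \<cdot> x) x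
        = complex_of_real ((norm T)\<^sup>2 * (norm x)\<^sup>2 - (norm (T \<cdot> x))\<^sup>2)"
      by (simp add: cinner_diff_left cinner_scaleC_left cinner_adj_bop' cinner_norm)
    ultimately show "0 \<le> Re (cinner ((?r *\<^sub>C 1 - T\<^sup>\<star> * T) \<cdot> x) x)"
      by (simp only: Re_complex_of_real)
  qed
  then obtain c where c: "?r *\<^sub>C 1 - T\<^sup>\<star> * T = c\<^sup>\<star> * c" using positive_bop_factor by blast
  have "0 \<le> Re (\<phi> (?r *\<^sub>C 1 - T\<^sup>\<star> * T))"
    unfolding c by (rule state_pos(1)[OF assms])
  then show ?thesis using assms by (simp add: state_diff state_scaleC state_one)
qed

lemma state_bounded:
  fixes \<phi> :: "'h::complex_hilbert bop \<Rightarrow> complex"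
  assumes "state \<phi>"
  shows "cmod (\<phi> T) \<le> norm T"
proof -
  have "(cmod (\<phi> T))\<^sup>2 \<le> Re (\<phi> (T\<^sup>\<star> * T))"
    using state_Cauchy_Schwarz[OF assms, of 1 T] by (simp add: state_one assms)
  also have "\<dots> \<le> (norm T)\<^sup>2" by (rule state_square_le[OF assms])
  finally show ?thesis by (rule power2_le_imp_le) simp
qed

lemma bop_of_bounded_clinear:
  fixes f :: "'h::complex_hilbert \<Rightarrow> 'h"
  assumes "clinear f" and "\<And>x. norm (f x) \<le> K * norm x"
  shows "\<exists>T. \<forall>x. T \<cdot> x = f x"
proof -
  have "bounded_linear f"
    by (rule bounded_linear_intro[of f K])
      (use assms in \<open>simp_all add: clinear_def scaleR_scaleC mult.commute\<close>)
  then have "Bop (Blinfun f) \<cdot> x = f x" for x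
    unfolding bop_apply.rep_eq
    by (subst Bop_inverse) (use assms in \<open>simp_all add: bounded_linear_Blinfun_apply clinear_def\<close>)
  then show ?thesis by blast
qed

text \<open>The theorem of Riesz, applied in the first variable, gives the adjoint of \<open>T\<close>.\<close>

lemma bop_of_sesquilinear:
  fixes s :: "'h::complex_hilbert \<Rightarrow> 'h \<Rightarrow> complex"
  assumes left: "\<And>y. clinear (\<lambda>x. s x y)"
    and add: "\<And>x y z. s x (y + z) = s x y + s x z"
    and sc: "\<And>x c y. s x (c *\<^sub>C y) = cnj c * s x y"
    and bnd: "\<And>x y. cmod (s x y) \<le> K * norm x * norm y"
  shows "\<exists>T. \<forall>x y. s x y = cinner (T \<cdot> x) y"
proof -
  have "\<exists>z. \<forall>x. s x y = cinner x z" for y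
    by (rule riesz_representation[of _ "K * norm y"]) (use left bnd in \<open>simp_all add: mult_ac\<close>)
  then obtain A where A: "\<And>x y. s x y = cinner x (A y)" by metis
  have "norm (A y) \<le> K * norm y" for y
  proof (cases "A y = 0")
    case False
    have "norm (A y) * norm (A y) = cmod (s (A y) y)"
      by (simp add: A cinner_norm norm_mult power2_eq_square)
    also have "\<dots> \<le> (K * norm y) * norm (A y)" using bnd[of "A y" y] by (simp add: mult_ac)
    finally show ?thesis using False by simp
  next
    case True
    obtain v :: 'h where "v \<noteq> 0" using nonzero by blast
    then have "0 \<le> K * norm y"
      using order_trans[OF norm_ge_zero bnd[of v y]] by (auto simp: zero_le_mult_iff)
    with True show ?thesis by simp
  qed
  moreover have "clinear A"
  proof (unfold clinear_def, intro conjI allI)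
    show "A (x + y) = A x + A y" for x y
      by (rule cinner_eqI) (simp add: cinner_add_right add flip: A)
    show "A (c *\<^sub>C x) = c *\<^sub>C A x" for c x
      by (rule cinner_eqI) (simp add: cinner_scaleC_right sc flip: A)
  qed
  ultimately obtain S where S: "\<And>y. S \<cdot> y = A y" using bop_of_bounded_clinear by metis
  have "s x y = cinner (S\<^sup>\<star> \<cdot> x) y" for x y by (simp add: A cinner_adj_bop' S)
  then show ?thesis by blast
qed

section \<open>Finite-rank projections\<close>

definition rank_one :: "'h::complex_hilbert \<Rightarrow> 'h \<Rightarrow> 'h bop" where
  "rank_one u v = (SOME T. \<forall>x. T \<cdot> x = cinner x v *\<^sub>C u)"

lemma rank_one_apply [simp]: "rank_one u v \<cdot> x = cinner x v *\<^sub>C u"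
proof -
  have "\<exists>T. \<forall>x. T \<cdot> x = cinner x v *\<^sub>C u"
  proof (rule bop_of_bounded_clinear)
    show "clinear (\<lambda>x. cinner x v *\<^sub>C u)"
      by (simp add: clinear_def cinner_add_left cinner_scaleC_left scaleC_add_left scaleC_scaleC)
    show "norm (cinner x v *\<^sub>C u) \<le> (norm v * norm u) * norm x" for x
      using mult_right_mono[OF cinner_Cauchy_Schwarz[of x v], of "norm u"]
      by (simp add: norm_scaleC mult_ac)
  qed
  from someI_ex[OF this] show ?thesis by (simp add: rank_one_def)
qed

lemma adj_rank_one: "(rank_one u v)\<^sup>\<star> = rank_one v u"
  by (rule adj_bop_eqI)
    (simp add: cinner_scaleC_left cinner_scaleC_right mult.commute flip: cinner_commute)

lemma mult_rank_one: "T * rank_one u v = rank_one (T \<cdot> u) v"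
  by (rule bop_eqI) (simp add: bop_apply_right)

text \<open>The real span suffices: complex scalars are absorbed by the vectors of \<open>rank_one u v\<close>.\<close>

definition finite_rank :: "'h::complex_hilbert bop set" where
  "finite_rank = span (range (\<lambda>(u, v). rank_one u v))"

definition finite_projections :: "'h::complex_hilbert bop set" where
  "finite_projections = {p \<in> finite_rank. p\<^sup>\<star> = p \<and> p * p = p}"

text \<open>One Gram--Schmidt step: add to \<open>p\<close> the projection \<open>E\<close> onto the line spanned by \<open>x - p x\<close>.\<close>

lemma extend_projection_vector:
  assumes p: "p \<in> finite_projections"
  shows "\<exists>q\<in>finite_projections. q * p = p \<and> q \<cdot> x = x"
proof (cases "p \<cdot> x = x")
  case True
  with p show ?thesis by (auto simp: finite_projections_def)
next
  case False
  have pfr: "p \<in> finite_rank" and psa: "p\<^sup>\<star> = p" and pp: "p * p = p"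
    using p by (auto simp: finite_projections_def)
  define r where "r = x - p \<cdot> x"
  define E where "E = (1 / (norm r)\<^sup>2) *\<^sub>R rank_one r r"
  have r0: "r \<noteq> 0" using False by (simp add: r_def)
  have pr: "p \<cdot> r = 0"
    using pp by (simp add: r_def bop_apply_right flip: bop_apply_simps(6))
  have E_apply: "E \<cdot> y = (cinner y r / (norm r)\<^sup>2) *\<^sub>C r" for y
    by (simp add: E_def scaleR_scaleC scaleC_scaleC)
  have Ep: "E * p = 0"
    by (rule bop_eqI) (simp add: E_apply cinner_adj_bop psa pr)
  have pE: "p * E = 0"
    by (rule bop_eqI) (simp add: E_apply bop_apply_right pr)
  have EE: "E * E = E"
    by (rule bop_eqI) (simp add: E_apply cinner_scaleC_left cinner_norm r0)
  have Esa: "E\<^sup>\<star> = E" by (simp add: E_def adj_scaleR adj_rank_one)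
  have "cinner (p \<cdot> x) r = 0" by (simp add: cinner_adj_bop psa pr)
  then have "cinner x r = cinner r r" by (simp add: r_def cinner_diff_left)
  then have Ex: "E \<cdot> x = r" by (simp add: E_apply cinner_norm r0 scaleC_one)
  have "E \<in> finite_rank"
    unfolding E_def finite_rank_def by (intro span_scale span_base) auto
  then have "p + E \<in> finite_rank"
    using pfr unfolding finite_rank_def by (rule span_add[rotated])
  then have "p + E \<in> finite_projections"
    by (simp add: finite_projections_def adj_add psa Esa distrib_left distrib_right pp EE Ep pE)
  moreover have "(p + E) * p = p" by (simp add: distrib_right pp Ep)
  moreover have "(p + E) \<cdot> x = x" by (simp add: Ex) (simp add: r_def)
  ultimately show ?thesis by blast
qed

text \<open>With \<open>a\<close> a projection this makes the family of finite-rank projections directed.\<close>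

lemma extend_projection:
  assumes "a \<in> finite_rank" and "p \<in> finite_projections"
  shows "\<exists>q\<in>finite_projections. q * p = p \<and> q * a = a"
proof -
  have "\<forall>p\<in>finite_projections. \<exists>q\<in>finite_projections. q * p = p \<and> q * a = a"
    using assms(1) unfolding finite_rank_def
  proof (induction rule: span_induct_alt)
    case base
    show ?case by (auto simp: finite_projections_def)
  next
    case (step c e y)
    then obtain u v where e: "e = rank_one u v" by auto
    show ?case
    proof
      fix p :: "'a bop" assume "p \<in> finite_projections"
      with step obtain q1 where q1: "q1 \<in> finite_projections" "q1 * p = p" "q1 * y = y" by blast
      obtain q2 where q2: "q2 \<in> finite_projections" "q2 * q1 = q1" "q2 \<cdot> u = u"
        using extend_projection_vector[OF q1(1)] by blast
      have "q2 * z = z" if "q1 * z = z" for z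
        by (metis that q2(2) mult.assoc)
      then have "q2 * p = p" "q2 * (c *\<^sub>R e + y) = c *\<^sub>R e + y"
        using q1 q2 by (simp_all add: distrib_left e mult_rank_one)
      with q2(1) show "\<exists>q\<in>finite_projections. q * p = p \<and> q * (c *\<^sub>R e + y) = c *\<^sub>R e + y"
        by blast
    qed
  qed
  with assms(2) show ?thesis by blast
qed

lemma zero_finite_projection: "0 \<in> finite_projections"
  by (simp add: finite_projections_def finite_rank_def span_zero)

lemma projection_le:
  fixes p q :: "'a::star_algebra"
  assumes "p\<^sup>\<star> = p" "p * p = p" "q\<^sup>\<star> = q" "q * q = q" "q * p = p"
  shows "p \<preceq> q"
proof -
  have "p * q = p" using assms adj_mult[of q p] by simp
  then have "q - p = (q - p)\<^sup>\<star> * (q - p)"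
    using assms by (simp add: adj_diff algebra_simps)
  then show ?thesis unfolding star_le_def by blast
qed

lemma sa_directed_finite_projections:
  "sa_directed (finite_projections :: 'h::complex_hilbert bop set)"
  unfolding sa_directed_def
proof (intro conjI ballI)
  show "(finite_projections :: 'h bop set) \<noteq> {}" using zero_finite_projection by auto
  fix p q :: "'h bop"
  assume pq: "p \<in> finite_projections" "q \<in> finite_projections"
  show "p\<^sup>\<star> = p" using pq by (simp add: finite_projections_def)
  from pq obtain f where f: "f \<in> finite_projections" "f * p = p" "f * q = q"
    using extend_projection[of q p] by (auto simp: finite_projections_def)
  then have "p \<preceq> f" "q \<preceq> f"
    using pq by (auto intro!: projection_le simp: finite_projections_def)
  with f(1) show "\<exists>f\<in>finite_projections. p \<preceq> f \<and> q \<preceq> f" by blast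
qed

text \<open>An upper bound \<open>t\<close> dominates, for each \<open>x\<close>, a projection that fixes \<open>x\<close>, so that the form of
  \<open>t - 1\<close> is positive; the factorization of positive operators turns this into \<open>1 \<preceq> t\<close>.\<close>

lemma sa_lub_finite_projections:
  "sa_lub finite_projections (1 :: 'h::complex_hilbert bop)"
  unfolding sa_lub_def
proof (intro conjI ballI allI impI)
  show "p \<preceq> 1" if "p \<in> finite_projections" for p :: "'h bop"
    using that by (intro projection_le) (auto simp: finite_projections_def)
  fix t :: "'h bop"
  assume t: "t\<^sup>\<star> = t \<and> (\<forall>p\<in>finite_projections. p \<preceq> t)"
  have "positive_bop (t - 1)"
    unfolding positive_bop_def
  proof (intro conjI allI)
    fix x :: 'h
    obtain p where p: "p \<in> finite_projections" "p \<cdot> x = x"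
      using extend_projection_vector[OF zero_finite_projection] by blast
    with t obtain c where "t - p = c\<^sup>\<star> * c" by (auto simp: star_le_def)
    moreover have "(t - 1) \<cdot> x = (t - p) \<cdot> x" by (simp add: p)
    ultimately have "cinner ((t - 1) \<cdot> x) x = cinner ((c\<^sup>\<star> * c) \<cdot> x) x" by simp
    then show "0 \<le> Re (cinner ((t - 1) \<cdot> x) x)"
      by (simp add: cinner_adj_bop' cinner_norm)
  qed (use t in \<open>simp add: adj_diff\<close>)
  then show "1 \<preceq> t" unfolding star_le_def by (rule positive_bop_factor)
qed simp


section \<open>Normal functionals\<close>

lemma subspace_closure_span: "subspace (closure (span W))"
  for W :: "'v::real_normed_vector set"
proof (rule subspaceI)
  show "0 \<in> closure (span W)" using closure_subset span_zero by blast
next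
  fix x y assume "x \<in> closure (span W)" "y \<in> closure (span W)"
  then obtain X Y where "\<And>n. X n \<in> span W" "X \<longlonglongrightarrow> x" "\<And>n. Y n \<in> span W" "Y \<longlonglongrightarrow> y"
    unfolding closure_sequential by blast
  then show "x + y \<in> closure (span W)"
    unfolding closure_sequential
    by (intro exI[of _ "\<lambda>n. X n + Y n"]) (simp add: span_add tendsto_add)
next
  fix c x assume "x \<in> closure (span W)"
  then obtain X where "\<And>n. X n \<in> span W" "X \<longlonglongrightarrow> x"
    unfolding closure_sequential by blast
  then show "c *\<^sub>R x \<in> closure (span W)"
    unfolding closure_sequential
    by (intro exI[of _ "\<lambda>n. c *\<^sub>R X n"]) (simp add: span_scale tendsto_scaleR)
qed

lemma closure_span_base: "w \<in> W \<Longrightarrow> w \<in> closure (span W)"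
  for W :: "'v::real_normed_vector set"
  using closure_subset[of "span W"] span_base[of w W] by blast

text \<open>\<open>L\<close> is controlled on the closed span only and may be arbitrary outside; the functionals on a
  predual that occur in its definition are of this kind.\<close>

lemma vanish_on_closure_span:
  fixes L :: "'v::real_normed_vector \<Rightarrow> 'w::real_normed_vector" and W :: "'v set"
  defines "V \<equiv> closure (span W)"
  assumes add: "\<And>f g. f \<in> V \<Longrightarrow> g \<in> V \<Longrightarrow> L (f + g) = L f + L g"
    and sc: "\<And>r f. f \<in> V \<Longrightarrow> L (r *\<^sub>R f) = r *\<^sub>R L f"
    and bnd: "\<And>f. f \<in> V \<Longrightarrow> norm (L f) \<le> K * norm f"
    and zero: "\<And>w. w \<in> W \<Longrightarrow> L w = 0"
    and f: "f \<in> V"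
  shows "L f = 0"
proof -
  have sub: "subspace V" unfolding V_def by (rule subspace_closure_span)
  have spanV: "span W \<subseteq> V" unfolding V_def by (rule closure_subset)
  have L0: "g \<in> V \<and> L g = 0" if "g \<in> span W" for g
    using that
  proof (induction rule: span_induct_alt)
    case base
    show ?case using sc[OF subspace_0[OF sub], of 0] subspace_0[OF sub] by simp
  next
    case (step c w g)
    have "w \<in> V" "c *\<^sub>R w \<in> V"
      using spanV span_base[OF step(1)] span_scale[OF span_base[OF step(1)], of c] by auto
    with step show ?case by (simp add: add sc zero subspace_add[OF sub])
  qed
  have small: "norm (L f) \<le> \<bar>K\<bar> * e" if e: "e > 0" for e
  proof -
    obtain g where g: "g \<in> span W" "dist g f < e"
      using f e unfolding V_def closure_approachable by blast
    have gV: "g \<in> V" "f - g \<in> V" using g spanV subspace_diff[OF sub f] by auto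
    have "L f = L (f - g)" using add[OF gV(2) gV(1)] L0[OF g(1)] by simp
    then have "norm (L f) \<le> K * norm (f - g)" using bnd[OF gV(2)] by simp
    also have "\<dots> \<le> \<bar>K\<bar> * norm (f - g)" by (intro mult_right_mono) simp_all
    also have "\<dots> \<le> \<bar>K\<bar> * e"
      using g(2) by (intro mult_left_mono) (simp_all add: dist_norm norm_minus_commute)
    finally show ?thesis .
  qed
  have "norm (L f) \<le> 0"
  proof (rule field_le_epsilon)
    fix e :: real assume e: "0 < e"
    have "norm (L f) \<le> \<bar>K\<bar> * (e / (\<bar>K\<bar> + 1))" using e by (intro small) simp
    also have "\<dots> \<le> e" using e by (simp add: field_simps)
    finally show "norm (L f) \<le> 0 + e" by simp
  qed
  then show ?thesis by simp
qed

lemma image_closure_span: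
  assumes C: "bounded_linear C" and W: "\<And>w. w \<in> W \<Longrightarrow> C w \<in> closure (span W')"
    and f: "f \<in> closure (span W)"
  shows "C f \<in> closure (span W')"
proof -
  have lin: "linear C" using C by (rule bounded_linear.linear)
  have "C ` closure (span W) \<subseteq> closure (C ` span W)"
    by (rule closure_bounded_linear_image_subset[OF C])
  also have "C ` span W = span (C ` W)" by (rule linear_span_image[OF lin, symmetric])
  also have "closure (span (C ` W)) \<subseteq> closure (span W')"
    using W by (intro closure_minimal span_minimal subspace_closure_span closed_closure) auto
  finally show ?thesis using f by blast
qed

lemma bounded_linear_precompose: "bounded_linear (\<lambda>f. f o\<^sub>L q)"
  by (rule bounded_bilinear.bounded_linear_left[OF bounded_bilinear_blinfun_compose])

definition vector_functional :: "'h::complex_hilbert \<Rightarrow> 'h \<Rightarrow> 'h bop \<Rightarrow>\<^sub>L complex" where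
  "vector_functional u v = Blinfun (\<lambda>T. cinner (T \<cdot> u) v)"

lemma vector_functional_apply [simp]:
  "blinfun_apply (vector_functional u v) T = cinner (T \<cdot> u) v"
proof -
  have "bounded_linear (\<lambda>T. cinner (T \<cdot> u) v)"
  proof (rule bounded_linear_intro[of _ "norm u * norm v"])
    show "norm (cinner (T \<cdot> u) v) \<le> norm T * (norm u * norm v)" for T
      using cinner_Cauchy_Schwarz[of "T \<cdot> u" v]
        mult_right_mono[OF norm_bop_apply[of T u], of "norm v"] by (simp add: mult_ac)
  qed (simp_all add: cinner_add_left scaleR_scaleC cinner_scaleC_left scaleC_complex_def)
  then show ?thesis by (simp add: vector_functional_def bounded_linear_Blinfun_apply)
qed

text \<open>This is the predual of \<open>\<B>(H)\<close>, the trace class, as a space of functionals.\<close>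

definition normal_functionals :: "('h::complex_hilbert bop \<Rightarrow>\<^sub>L complex) set" where
  "normal_functionals = closure (span (range (\<lambda>(u, v). vector_functional u v)))"

text \<open>By normality some finite-rank projection \<open>p\<close> has \<open>\<phi> (1 - p)\<close> small, and by the Cauchy--Schwarz
  inequality \<open>T \<mapsto> \<phi> (T p)\<close> is then close to \<open>\<phi>\<close> in norm. The value \<open>\<phi> (T * rank_one u v)\<close>
  depends on \<open>T\<close> only through a linear functional of \<open>T u\<close>, so \<open>T \<mapsto> \<phi> (T p)\<close> is a finite sum of vector functionals.\<close>

lemma normal_state_in_normal_functionals:
  fixes \<phi> :: "'h::complex_hilbert bop \<Rightarrow> complex"
  assumes st: "state \<phi>" and nrm: "normal \<phi>"
  shows "\<exists>g\<in>normal_functionals. \<forall>T. blinfun_apply g T = \<phi> T"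
proof -
  have scR: "\<phi> (r *\<^sub>R T) = r *\<^sub>R \<phi> T" for r T
    by (simp add: scaleR_scaleC state_scaleC[OF st] scaleC_complex_def)
  have bl: "bounded_linear (\<lambda>T. \<phi> (T * a))" for a
  proof (rule bounded_linear_intro[of _ "norm a"])
    show "norm (\<phi> (T * a)) \<le> norm T * norm a" for T
      using state_bounded[OF st, of "T * a"] norm_mult_ineq[of T a] by linarith
  qed (simp_all add: distrib_right state_add[OF st] scR)
  define h where "h a = Blinfun (\<lambda>T. \<phi> (T * a))" for a
  have h: "blinfun_apply (h a) T = \<phi> (T * a)" for a T
    by (simp add: h_def bounded_linear_Blinfun_apply[OF bl])
  have h_fr: "h a \<in> span (range (\<lambda>(u, v). vector_functional u v))" if "a \<in> finite_rank" for a
    using that unfolding finite_rank_def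
  proof (induction rule: span_induct_alt)
    case base
    have "h 0 = 0"
      by (rule blinfun_eqI) (use scR[of 0 1] in \<open>simp add: h\<close>)
    then show ?case by (simp add: span_zero)
  next
    case (step c e y)
    then obtain u v where e: "e = rank_one u v" by auto
    have r1: "rank_one (x + y) v = rank_one x v + rank_one y v"
      "rank_one (c *\<^sub>C x) v = c *\<^sub>C rank_one x v" for x y c
      by (rule bop_eqI, simp add: scaleC_add_right scaleC_scaleC mult.commute)+
    have "\<exists>z. \<forall>x. \<phi> (rank_one x v) = cinner x z"
    proof (rule riesz_representation)
      show "clinear (\<lambda>x. \<phi> (rank_one x v))"
        by (simp add: clinear_def r1 state_add[OF st] state_scaleC[OF st] scaleC_complex_def)
      show "cmod (\<phi> (rank_one x v)) \<le> norm v * norm x" for x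
      proof -
        have "norm (rank_one x v) \<le> norm v * norm x"
        proof (rule norm_bop_bound)
          show "norm (rank_one x v \<cdot> w) \<le> norm v * norm x * norm w" for w
            using mult_right_mono[OF cinner_Cauchy_Schwarz[of w v], of "norm x"]
            by (simp add: norm_scaleC mult_ac)
        qed simp
        with state_bounded[OF st] show ?thesis by (rule order_trans)
      qed
    qed
    then obtain z where z: "\<And>x. \<phi> (rank_one x v) = cinner x z" by blast
    have "h e = vector_functional u z"
      by (rule blinfun_eqI) (simp add: h e mult_rank_one z)
    then have "h e \<in> span (range (\<lambda>(u, v). vector_functional u v))"
      by (auto intro: span_base)
    moreover have "h (c *\<^sub>R e + y) = c *\<^sub>R h e + h y"
      by (rule blinfun_eqI)
        (simp add: h distrib_left state_add[OF st] scR blinfun.add_left blinfun.scaleR_left)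
    ultimately show ?case using step by (simp add: span_add span_scale)
  qed
  have "h 1 \<in> normal_functionals"
    unfolding normal_functionals_def closure_approachable
  proof (intro allI impI)
    fix e :: real assume e: "0 < e"
    have "Re (\<phi> 1) = (SUP p\<in>finite_projections. Re (\<phi> p))"
      using nrm sa_directed_finite_projections sa_lub_finite_projections
      unfolding normal_def by blast
    then have sup: "1 - (e / 2)\<^sup>2 < (SUP p\<in>finite_projections. Re (\<phi> p))"
      using e by (simp add: state_one[OF st])
    have bdd: "bdd_above ((\<lambda>p. Re (\<phi> p)) ` finite_projections)"
    proof (rule bdd_aboveI2)
      fix p :: "'h bop" assume "p \<in> finite_projections"
      then have "(1 - p)\<^sup>\<star> * (1 - p) = 1 - p"
        by (simp add: finite_projections_def adj_diff algebra_simps)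
      then show "Re (\<phi> p) \<le> 1"
        using state_pos(1)[OF st, of "1 - p"] by (simp add: state_diff[OF st] state_one[OF st])
    qed
    have ne: "(finite_projections :: 'h bop set) \<noteq> {}" using zero_finite_projection by blast
    obtain p where p: "p \<in> finite_projections" "1 - (e / 2)\<^sup>2 < Re (\<phi> p)"
      using sup less_cSUP_iff[OF ne bdd] by blast
    have proj: "(1 - p)\<^sup>\<star> * (1 - p) = 1 - p"
      using p(1) by (simp add: finite_projections_def adj_diff algebra_simps)
    have "norm (h 1 - h p) \<le> e / 2"
    proof (rule norm_blinfun_bound)
      fix T
      have "blinfun_apply (h 1 - h p) T = \<phi> ((T\<^sup>\<star>)\<^sup>\<star> * (1 - p))"
        by (simp add: blinfun.diff_left h right_diff_distrib state_diff[OF st] adj_adj)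
      then have "(cmod (blinfun_apply (h 1 - h p) T))\<^sup>2
          \<le> Re (\<phi> (1 - p)) * Re (\<phi> ((T\<^sup>\<star>)\<^sup>\<star> * T\<^sup>\<star>))"
        using state_Cauchy_Schwarz[OF st, of "T\<^sup>\<star>" "1 - p"] by (simp add: proj)
      also have "\<dots> \<le> (e / 2)\<^sup>2 * (norm (T\<^sup>\<star>))\<^sup>2"
      proof (intro mult_mono state_square_le[OF st])
        show "Re (\<phi> (1 - p)) \<le> (e / 2)\<^sup>2"
          using p(2) by (simp add: state_diff[OF st] state_one[OF st])
      qed (simp_all add: state_pos(1)[OF st])
      also have "\<dots> = (e / 2 * norm T)\<^sup>2" by (simp add: power2_eq_square)
      finally show "norm (blinfun_apply (h 1 - h p) T) \<le> e / 2 * norm T"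
        using e by (intro power2_le_imp_le[of "cmod (blinfun_apply (h 1 - h p) T)"]) simp_all
    qed (use e in simp)
    then have "dist (h p) (h 1) < e" using e by (simp add: dist_norm norm_minus_commute)
    moreover have "h p \<in> span (range (\<lambda>(u, v). vector_functional u v))"
      using p(1) by (intro h_fr) (simp add: finite_projections_def)
    ultimately show "\<exists>g\<in>span (range (\<lambda>(u, v). vector_functional u v)). dist g (h 1) < e"
      by blast
  qed
  then show ?thesis by (intro bexI[of _ "h 1"]) (simp_all add: h)
qed

lemma normal_functional_compress:
  assumes g: "g \<in> normal_functionals"
  shows "\<exists>g'\<in>normal_functionals. \<forall>T. blinfun_apply g' T = blinfun_apply g (b\<^sup>\<star> * T * a)"
proof -
  have bl: "bounded_linear (\<lambda>T. b\<^sup>\<star> * T * a)"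
    using bounded_linear_compose[OF bounded_linear_mult_left bounded_linear_mult_right] .
  define q where "q = Blinfun (\<lambda>T. b\<^sup>\<star> * T * a)"
  have q: "blinfun_apply q T = b\<^sup>\<star> * T * a" for T
    by (simp add: q_def bounded_linear_Blinfun_apply[OF bl])
  have "g o\<^sub>L q \<in> normal_functionals"
    using g unfolding normal_functionals_def
  proof (rule image_closure_span[OF bounded_linear_precompose, rotated])
    fix w assume "w \<in> range (\<lambda>(u, v). vector_functional u v :: 'a bop \<Rightarrow>\<^sub>L complex)"
    then obtain u v where "w = vector_functional u v" by auto
    then have "w o\<^sub>L q = vector_functional (a \<cdot> u) (b \<cdot> v)"
      by (intro blinfun_eqI) (simp add: q cinner_adj_bop')
    then show "w o\<^sub>L q \<in> closure (span (range (\<lambda>(u, v). vector_functional u v)))"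
      by (auto intro: closure_span_base)
  qed
  then show ?thesis by (intro bexI[of _ "g o\<^sub>L q"]) (simp_all add: q)
qed


section \<open>Preduals of weak-\<open>*\<close> closed subspaces\<close>

text \<open>The predual consists of the restrictions of normal functionals. A bounded functional \<open>L\<close> on it is
  given on vector functionals by a bounded sesquilinear form, hence by an operator \<open>T\<close>, and then
  \<open>L\<close> is evaluation at \<open>T\<close> on all normal functionals. Those in \<open>G\<close> restrict to \<open>0\<close>, so they
  vanish at \<open>T\<close>, which puts \<open>T\<close> into the range.\<close>

theorem von_neumann_algebra_of_weak_star_closed_range:
  fixes Q :: "'b::cstar_algebra \<Rightarrow> 'h::complex_hilbert bop"
  assumes lin: "clinear Q" and iso: "\<And>b. norm (Q b) = norm b"
    and G: "G \<subseteq> normal_functionals"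
    and range: "range Q = {T. \<forall>g\<in>G. blinfun_apply g T = 0}"
  shows "von_neumann_algebra TYPE('b)"
proof -
  have Qadd: "Q (a + b) = Q a + Q b" and Qsc: "Q (c *\<^sub>C a) = c *\<^sub>C Q a" for a b c
    using lin by (simp_all add: clinear_def)
  have blQ: "bounded_linear Q"
    by (rule bounded_linear_intro[of _ 1]) (simp_all add: Qadd Qsc scaleR_scaleC iso)
  define q where "q = Blinfun Q"
  have q [simp]: "blinfun_apply q = Q"
    by (simp add: q_def bounded_linear_Blinfun_apply[OF blQ])
  define vf where "vf u v = vector_functional u v o\<^sub>L q" for u v
  have vf [simp]: "blinfun_apply (vf u v) b = cinner (Q b \<cdot> u) v" for u v b
    by (simp add: vf_def)
  define W where "W = range (\<lambda>(u, v). vf u v)"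
  define F where "F = closure (span W)"
  have vfF: "vf u v \<in> F" for u v
    unfolding F_def W_def by (rule closure_span_base) auto
  have sub: "subspace F" unfolding F_def by (rule subspace_closure_span)
  have W_cases: "\<exists>u v. w = vf u v" if "w \<in> W" for w
    using that by (auto simp: W_def)
  have vf_norm: "norm (vf u v) \<le> norm u * norm v" for u v
  proof (rule norm_blinfun_bound)
    show "norm (blinfun_apply (vf u v) b) \<le> norm u * norm v * norm b" for b
      using cinner_Cauchy_Schwarz[of "Q b \<cdot> u" v]
        mult_right_mono[OF norm_bop_apply[of "Q b" u], of "norm v"]
      by (simp add: iso mult_ac)
  qed simp
  have pull: "g o\<^sub>L q \<in> F" if g: "g \<in> normal_functionals" for g
    using g unfolding normal_functionals_def F_def
    by (rule image_closure_span[OF bounded_linear_precompose, rotated])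
      (auto intro!: closure_span_base simp: W_def vf_def)
  have homog: "blinfun_apply f (c *\<^sub>C a) = c * blinfun_apply f a" if "f \<in> F" for f c a
  proof -
    have "blinfun_apply f (c *\<^sub>C a) - c * blinfun_apply f a = 0"
    proof (rule vanish_on_closure_span[of W])
      show "f \<in> closure (span W)" using that by (simp add: F_def)
      show "blinfun_apply w (c *\<^sub>C a) - c * blinfun_apply w a = 0" if "w \<in> W" for w
        using W_cases[OF that] by (auto simp: Qsc cinner_scaleC_left)
      show "norm (blinfun_apply f (c *\<^sub>C a) - c * blinfun_apply f a)
          \<le> (norm (c *\<^sub>C a) + cmod c * norm a) * norm f" for f :: "'b \<Rightarrow>\<^sub>L complex"
      proof -
        have "norm (blinfun_apply f (c *\<^sub>C a) - c * blinfun_apply f a)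
            \<le> norm (blinfun_apply f (c *\<^sub>C a)) + cmod c * norm (blinfun_apply f a)"
          by (rule norm_triangle_le_diff) (simp add: norm_mult)
        also have "\<dots> \<le> norm f * norm (c *\<^sub>C a) + cmod c * (norm f * norm a)"
          by (intro add_mono mult_left_mono norm_blinfun) simp
        finally show ?thesis by (simp add: algebra_simps)
      qed
    qed (simp_all add: blinfun.add_left blinfun.scaleR_left algebra_simps)
    then show ?thesis by simp
  qed
  have "is_predual F"
    unfolding is_predual_def
  proof (intro conjI ballI allI impI)
    show "clinear (blinfun_apply f)" if "f \<in> F" for f
      by (simp add: clinear_def blinfun.add_right homog[OF that] scaleC_complex_def)
    show "0 \<in> F" by (rule subspace_0[OF sub])
    show "f + g \<in> F" if "f \<in> F" "g \<in> F" for f g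
      using sub that by (rule subspace_add)
    show "closed F" by (simp add: F_def)
    show "\<exists>g\<in>F. \<forall>a. blinfun_apply g a = c * blinfun_apply f a" if f: "f \<in> F" for f c
    proof
      show "blinfun_mult_right c o\<^sub>L f \<in> F"
        using f unfolding F_def
      proof (rule image_closure_span[rotated 2])
        show "bounded_linear (\<lambda>f::'b \<Rightarrow>\<^sub>L complex. blinfun_mult_right c o\<^sub>L f)"
          by (rule bounded_bilinear.bounded_linear_right[OF bounded_bilinear_blinfun_compose])
        fix w assume "w \<in> W"
        then obtain u v where w: "w = vf u v" using W_cases by blast
        have "blinfun_mult_right c o\<^sub>L w = vf (c *\<^sub>C u) v"
          by (rule blinfun_eqI) (simp add: w bop_apply_right cinner_scaleC_left)
        then show "blinfun_mult_right c o\<^sub>L w \<in> closure (span W)"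
          using vfF[of "c *\<^sub>C u" v] by (simp add: F_def)
      qed
    qed simp
    show "norm a = (SUP f\<in>{f \<in> F. norm f \<le> 1}. cmod (blinfun_apply f a))" for a
    proof (rule antisym)
      let ?B = "{f \<in> F. norm f \<le> 1}" and ?S = "SUP f\<in>{f \<in> F. norm f \<le> 1}. cmod (blinfun_apply f a)"
      have ub: "cmod (blinfun_apply f a) \<le> norm a" if "f \<in> ?B" for f
        using norm_blinfun[of f a] mult_right_mono[of "norm f" 1 "norm a"] that by auto
      have bdd: "bdd_above ((\<lambda>f. cmod (blinfun_apply f a)) ` ?B)"
        using ub by (rule bdd_aboveI2)
      have zB: "0 \<in> ?B" using subspace_0[OF sub] by simp
      then show "?S \<le> norm a" using ub by (intro cSUP_least) auto
      have S: "cmod (blinfun_apply f a) \<le> ?S" if "f \<in> ?B" for f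
        using bdd that by (rule cSUP_upper2) simp
      have S0: "0 \<le> ?S" using S[OF zB] by simp
      have "norm (Q a) \<le> ?S"
      proof (rule norm_bop_bound[OF S0])
        fix x
        show "norm (Q a \<cdot> x) \<le> ?S * norm x"
        proof (cases "Q a \<cdot> x = 0")
          case True
          with S0 show ?thesis by simp
        next
          case False
          define y where "y = Q a \<cdot> x"
          have y: "norm y > 0" and x: "norm x > 0"
            using False by (auto simp: y_def bop_apply_right)
          define f where "f = vf ((1 / norm x) *\<^sub>R x) ((1 / norm y) *\<^sub>R y)"
          have fB: "f \<in> ?B"
            using vf_norm[of "(1 / norm x) *\<^sub>R x" "(1 / norm y) *\<^sub>R y"] vfF x y
            by (simp add: f_def)
          have "blinfun_apply f a = complex_of_real (norm y / norm x)"
            using x y by (simp add: f_def bop_apply_right y_def[symmetric] scaleR_scaleC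
                cinner_scaleC_left cinner_scaleC_right cinner_norm power2_eq_square)
          then have "cmod (blinfun_apply f a) = norm y / norm x"
            by (simp only: norm_of_real) simp
          with S[OF fB] have "norm y / norm x \<le> ?S" by (simp only:)
          then show ?thesis using x by (simp add: field_simps y_def)
        qed
      qed
      then show "norm a \<le> ?S" by (simp add: iso)
    qed
  next
    fix L :: "('b \<Rightarrow>\<^sub>L complex) \<Rightarrow> complex"
    assume L: "(\<forall>f\<in>F. \<forall>g\<in>F. L (f + g) = L f + L g) \<and>
        (\<forall>f\<in>F. \<forall>g\<in>F. \<forall>c. (\<forall>a. blinfun_apply g a = c * blinfun_apply f a) \<longrightarrow> L g = c * L f) \<and>
        (\<exists>K. \<forall>f\<in>F. cmod (L f) \<le> K * norm f)"
    then have Ladd: "L (f + g) = L f + L g" if "f \<in> F" "g \<in> F" for f g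
      using that by blast
    have Lc: "L g = c * L f" if "f \<in> F" "g \<in> F" "\<And>a. blinfun_apply g a = c * blinfun_apply f a"
      for f g c
      using L that by blast
    obtain K0 where K0: "\<And>f. f \<in> F \<Longrightarrow> cmod (L f) \<le> K0 * norm f" using L by blast
    \<comment> \<open>The estimates below multiply by the bound, which has to be nonnegative for that.\<close>
    define K where "K = \<bar>K0\<bar>"
    have K: "cmod (L f) \<le> K * norm f" if "f \<in> F" for f
      using K0[OF that] mult_right_mono[OF abs_ge_self[of K0] norm_ge_zero[of f]] by (simp add: K_def)
    have LR: "L (r *\<^sub>R f) = r *\<^sub>R L f" if "f \<in> F" for r f
      using Lc[OF that subspace_scale[OF sub that, of r], of "complex_of_real r"]
      by (simp add: blinfun.scaleR_left scaleR_conv_of_real)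
    have "\<exists>T. \<forall>u v. L (vf u v) = cinner (T \<cdot> u) v"
    proof (rule bop_of_sesquilinear)
      have "vf (u + u') v = vf u v + vf u' v" "vf u (v + v') = vf u v + vf u v'" for u u' v v'
        by (rule blinfun_eqI,
            simp add: blinfun.add_left bop_apply_right cinner_add_left cinner_add_right)+
      then have "L (vf (u + u') v) = L (vf u v) + L (vf u' v)"
        "L (vf u (v + v')) = L (vf u v) + L (vf u v')" for u u' v v'
        by (simp_all add: Ladd vfF)
      moreover have "L (vf (c *\<^sub>C u) v) = c * L (vf u v)" for c u v
        by (rule Lc) (simp_all add: vfF bop_apply_right cinner_scaleC_left)
      ultimately show "clinear (\<lambda>u. L (vf u v))"
        "L (vf u (v + v')) = L (vf u v) + L (vf u v')" for u v v'
        by (simp_all add: clinear_def scaleC_complex_def)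
      show "L (vf u (c *\<^sub>C v)) = cnj c * L (vf u v)" for u c v
        by (rule Lc) (simp_all add: vfF cinner_scaleC_right)
      show "cmod (L (vf u v)) \<le> K * norm u * norm v" for u v
        using K[OF vfF[of u v]] mult_left_mono[OF vf_norm[of u v], of K]
        by (simp add: K_def mult_ac)
    qed
    then obtain T where T: "\<And>u v. L (vf u v) = cinner (T \<cdot> u) v" by blast
    have LT: "L (g o\<^sub>L q) = blinfun_apply g T" if g: "g \<in> normal_functionals" for g
    proof -
      have nf: "h \<in> normal_functionals" if "h \<in> closure (span (range (\<lambda>(u, v). vector_functional u v)))"
        for h :: "'h bop \<Rightarrow>\<^sub>L complex"
        using that by (simp add: normal_functionals_def)
      have "L (g o\<^sub>L q) - blinfun_apply g T = 0"
      proof (rule vanish_on_closure_span[of "range (\<lambda>(u, v). vector_functional u v)"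
            "\<lambda>g. L (g o\<^sub>L q) - blinfun_apply g T" "K * norm q + norm T"])
        show "g \<in> closure (span (range (\<lambda>(u, v). vector_functional u v)))"
          using g by (simp add: normal_functionals_def)
        fix f h :: "'h bop \<Rightarrow>\<^sub>L complex"
        assume f: "f \<in> closure (span (range (\<lambda>(u, v). vector_functional u v)))"
        note fF = pull[OF nf[OF f]]
        show "L (r *\<^sub>R f o\<^sub>L q) - blinfun_apply (r *\<^sub>R f) T
            = r *\<^sub>R (L (f o\<^sub>L q) - blinfun_apply f T)" for r
        proof -
          have "r *\<^sub>R f o\<^sub>L q = r *\<^sub>R (f o\<^sub>L q)"
            by (rule blinfun_eqI) (simp add: blinfun.scaleR_left)
          then show ?thesis by (simp add: LR[OF fF] blinfun.scaleR_left scaleR_diff_right)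
        qed
        show "norm (L (f o\<^sub>L q) - blinfun_apply f T) \<le> (K * norm q + norm T) * norm f"
        proof -
          have "norm (L (f o\<^sub>L q) - blinfun_apply f T) \<le> norm (L (f o\<^sub>L q)) + norm (blinfun_apply f T)"
            by (rule norm_triangle_ineq4)
          also have "\<dots> \<le> K * (norm f * norm q) + norm f * norm T"
            using K[OF fF] mult_left_mono[OF norm_blinfun_compose[of f q], of K]
            by (intro add_mono norm_blinfun) (simp add: K_def)
          finally show ?thesis by (simp add: algebra_simps)
        qed
        assume h: "h \<in> closure (span (range (\<lambda>(u, v). vector_functional u v)))"
        have "(f + h) o\<^sub>L q = (f o\<^sub>L q) + (h o\<^sub>L q)"
          by (rule blinfun_eqI) (simp add: blinfun.add_left)
        then show "L ((f + h) o\<^sub>L q) - blinfun_apply (f + h) T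
            = L (f o\<^sub>L q) - blinfun_apply f T + (L (h o\<^sub>L q) - blinfun_apply h T)"
          by (simp add: Ladd fF pull[OF nf[OF h]] blinfun.add_left)
      next
        fix w assume "w \<in> range (\<lambda>(u, v). vector_functional u v :: 'h bop \<Rightarrow>\<^sub>L complex)"
        then obtain u v where "w = vector_functional u v" by auto
        then show "L (w o\<^sub>L q) - blinfun_apply w T = 0"
          using T[of u v] by (simp add: vf_def)
      qed
      then show ?thesis by simp
    qed
    have "blinfun_apply g T = 0" if "g \<in> G" for g
    proof -
      have "blinfun_apply g (Q b) = 0" for b
        using range that by blast
      then have "g o\<^sub>L q = 0" by (intro blinfun_eqI) simp
      moreover have "L 0 = 0" using LR[OF subspace_0[OF sub], of 0] by simp
      ultimately show ?thesis using LT[of g] G that by auto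
    qed
    then have "T \<in> range Q" using range by blast
    then obtain a where a: "T = Q a" by blast
    have "L f = blinfun_apply f a" if f: "f \<in> F" for f
    proof -
      have "L f - blinfun_apply f a = 0"
      proof (rule vanish_on_closure_span[of W "\<lambda>f. L f - blinfun_apply f a" "K + norm a"];
          (fold F_def)?)
        show "norm (L f - blinfun_apply f a) \<le> (K + norm a) * norm f" if "f \<in> F" for f
          using norm_triangle_ineq4[of "L f" "blinfun_apply f a"] K[OF that] norm_blinfun[of f a]
          by (simp add: algebra_simps)
        show "L w - blinfun_apply w a = 0" if "w \<in> W" for w
          using W_cases[OF that] T a by auto
      qed (simp_all add: f Ladd LR blinfun.add_left blinfun.scaleR_left scaleR_diff_right)
      then show ?thesis by simp
    qed
    then show "\<exists>a. \<forall>f\<in>F. L f = blinfun_apply f a" by blast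
  qed
  then show ?thesis unfolding von_neumann_algebra_def by blast
qed


section \<open>Harmonic operators\<close>

lemma standard_representation_dense_eqI:
  fixes hat :: "'m::cstar_algebra \<Rightarrow> 'h::complex_hilbert"
  assumes "standard_representation \<tau> hat lm" and "\<And>y. S \<cdot> hat y = T \<cdot> hat y"
  shows "S = T"
proof (rule bop_eqI)
  fix x
  have bl: "bounded_linear ((\<cdot>) T)" for T :: "'h bop"
    by (rule bounded_linear_intro[of _ "norm T"])
      (simp_all add: bop_apply_right norm_bop_apply mult.commute[of _ "norm T"])
  have "closed {x. S \<cdot> x = T \<cdot> x}"
    by (intro closed_Collect_eq linear_continuous_on bl)
  then have "closure (range hat) \<subseteq> {x. S \<cdot> x = T \<cdot> x}"
    using assms(2) by (intro closure_minimal) auto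
  then show "S \<cdot> x = T \<cdot> x"
    using assms(1) by (auto simp: standard_representation_def)
qed

lemma standard_representation_one:
  assumes "standard_representation \<tau> hat lm"
  shows "lm 1 = 1"
  by (rule standard_representation_dense_eqI[OF assms])
    (use assms in \<open>simp add: standard_representation_def\<close>)

lemma standard_representation_mult:
  assumes "standard_representation \<tau> hat lm"
  shows "lm (x * y) = lm x * lm y"
  by (rule standard_representation_dense_eqI[OF assms])
    (use assms in \<open>simp add: standard_representation_def mult.assoc\<close>)

lemma commutant_separating:
  assumes st: "standard_representation \<tau> hat lm"
    and T: "T \<in> commutant (range lm)" and 0: "T \<cdot> hat 1 = 0"
  shows "T = 0"
proof (rule standard_representation_dense_eqI[OF st])
  fix y
  have "T \<cdot> hat y = (T * lm y) \<cdot> hat 1"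
    using st by (simp add: standard_representation_def)
  also have "T * lm y = lm y * T" using T by (simp add: commutant_def)
  finally show "T \<cdot> hat y = 0 \<cdot> hat y" by (simp add: 0 bop_apply_right)
qed

lemma star_subalgebra_commutant:
  fixes A :: "'a::star_algebra set"
  assumes "\<And>a. a \<in> A \<Longrightarrow> a\<^sup>\<star> \<in> A"
  shows "star_subalgebra (commutant A)"
  unfolding star_subalgebra_def
proof (intro conjI ballI allI)
  fix x y assume x: "x \<in> commutant A" and y: "y \<in> commutant A"
  then show "x + y \<in> commutant A" by (simp add: commutant_def distrib_left distrib_right)
  have "x * y * a = a * (x * y)" if "a \<in> A" for a
  proof -
    have xa: "x * a = a * x" and ya: "y * a = a * y" using x y that by (auto simp: commutant_def)
    have "x * y * a = x * a * y" by (simp only: mult.assoc ya)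
    then show ?thesis by (simp only: xa mult.assoc)
  qed
  then show "x * y \<in> commutant A" by (simp add: commutant_def)
next
  fix x c assume x: "x \<in> commutant A"
  then show "c *\<^sub>C x \<in> commutant A"
    by (simp add: commutant_def mult_scaleC_left mult_scaleC_right)
  have "x\<^sup>\<star> * a = a * x\<^sup>\<star>" if "a \<in> A" for a
  proof -
    have "x * a\<^sup>\<star> = a\<^sup>\<star> * x" using x assms[OF that] by (simp add: commutant_def)
    from arg_cong[OF this, of adj] show ?thesis by (simp add: adj_mult adj_adj)
  qed
  then show "x\<^sup>\<star> \<in> commutant A" by (simp add: commutant_def)
qed (simp add: commutant_def)

text \<open>For a harmonic \<open>T\<close> in the commutant, the Schwarz defect \<open>D\<close> is positive and lies in the
  commutant, and regularity gives \<open>\<langle>D (hat 1), hat 1\<rangle> = 0\<close>. So \<open>D (hat 1) = 0\<close>, hence \<open>D = 0\<close>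
  because \<open>hat 1\<close> is separating.\<close>

lemma star_subalgebra_Har_commutant:
  assumes st: "standard_representation \<tau> hat lm" and am: "associated_map hat lm \<phi> P"
    and reg: "regular hat lm P" and sa: "star_subalgebra (range lm)"
  shows "star_subalgebra (Har P \<inter> commutant (range lm))"
proof -
  define N where "N = commutant (range lm)"
  have N: "star_subalgebra N"
    unfolding N_def
    by (rule star_subalgebra_commutant) (use sa in \<open>unfold star_subalgebra_def, blast\<close>)
  have cp: "completely_positive P" and one: "P 1 = 1"
    and bim: "P (lm x * T * lm y) = lm x * P T * lm y" for x T y
    using am by (auto simp: associated_map_def)
  have Pclin: "P (S + T) = P S + P T" "P (c *\<^sub>C T) = c *\<^sub>C P T" for S T c
    using cp by (simp_all add: completely_positive_def clinear_def)
  have P0: "P 0 = 0" using Pclin(2)[of 0 0] by simp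
  have P_N: "P T \<in> N" if "T \<in> N" for T
  proof -
    have "P T * lm x = lm x * P T" for x
    proof -
      have "T * lm x = lm x * T" using that by (simp add: N_def commutant_def)
      then show ?thesis
        using bim[of x T 1] bim[of 1 T x] by (simp add: standard_representation_one[OF st])
    qed
    then show ?thesis by (auto simp: N_def commutant_def)
  qed
  have schwarz: "P (T\<^sup>\<star> * T) = (P T)\<^sup>\<star> * P T" if T: "T \<in> N" "P T = T" for T
  proof -
    obtain Z where Z: "\<And>i j::nat. i < 1 \<Longrightarrow> j < 1 \<Longrightarrow>
        P (T\<^sup>\<star> * T) - (P T)\<^sup>\<star> * P T = (\<Sum>k<Suc 1. (Z k i)\<^sup>\<star> * Z k j)"
      by (rule schwarz_defect[OF cp one, of 1 "\<lambda>_. T"]) blast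
    define D where "D = P (T\<^sup>\<star> * T) - T\<^sup>\<star> * T"
    have DZ: "D = (\<Sum>k<Suc 1. (Z k 0)\<^sup>\<star> * Z k 0)"
      using Z[of 0 0] T by (simp add: D_def)
    have TT: "T\<^sup>\<star> * T \<in> N" using N T by (simp add: star_subalgebra_def)
    have "D \<in> N"
      using P_N[OF TT] TT by (simp add: D_def N_def commutant_def algebra_simps)
    have "cinner (D \<cdot> hat 1) (hat 1) = 0"
      using reg TT unfolding regular_def N_def D_def by (simp add: cinner_diff_left)
    then have "Z k 0 \<cdot> hat 1 = 0" if "k < Suc 1" for k
      unfolding DZ using that by (rule sum_adj_mult_kernel)
    then have "D \<cdot> hat 1 = 0"
      unfolding DZ by (simp add: bop_apply_right)
    with \<open>D \<in> N\<close> have "D = 0" unfolding N_def by (rule commutant_separating[OF st])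
    then show ?thesis using T by (simp add: D_def)
  qed
  have adj: "T\<^sup>\<star> \<in> N \<and> P (T\<^sup>\<star>) = T\<^sup>\<star>" if "T \<in> N" "P T = T" for T
    using that N completely_positive_adj[OF cp, of T] by (simp add: star_subalgebra_def)
  have mult: "P (S * T) = S * T" if S: "S \<in> N" "P S = S" and T: "P T = T" for S T
    using multiplicative_domain[OF cp one schwarz[of "S\<^sup>\<star>"], of T] adj[OF S] T
    by (simp add: adj_adj)
  show ?thesis
    unfolding N_def[symmetric] star_subalgebra_def Har_def
    using N adj mult by (auto simp: star_subalgebra_def Pclin P0)
qed

text \<open>\<open>P T = T\<close> says that \<open>\<langle>T (hat y), hat z\<rangle> = \<phi> ((lm z)\<^sup>\<star> T (lm y))\<close> for all \<open>y\<close> and \<open>z\<close>, and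
  both sides are normal functionals of \<open>T\<close>.\<close>

lemma Har_annihilator:
  fixes \<phi> :: "'h::complex_hilbert bop \<Rightarrow> complex"
  assumes st: "standard_representation \<tau> hat lm" and am: "associated_map hat lm \<phi> P"
    and hs: "state \<phi>" and nrm: "normal \<phi>"
  shows "\<exists>G\<subseteq>normal_functionals. Har P = {T. \<forall>g\<in>G. blinfun_apply g T = 0}"
proof -
  have sub: "subspace (normal_functionals :: ('h bop \<Rightarrow>\<^sub>L complex) set)"
    unfolding normal_functionals_def by (rule subspace_closure_span)
  obtain g0 where g0: "g0 \<in> normal_functionals" "\<And>T. blinfun_apply g0 T = \<phi> T"
    using normal_state_in_normal_functionals[OF hs nrm] by blast
  have d: "\<exists>g\<in>normal_functionals. \<forall>T. blinfun_apply g T = cinner ((T - P T) \<cdot> hat y) (hat z)" for y z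
  proof -
    obtain g where g: "g \<in> normal_functionals" "\<And>T. blinfun_apply g T = \<phi> ((lm z)\<^sup>\<star> * T * lm y)"
      using normal_functional_compress[OF g0(1), of "lm z" "lm y"] g0(2) by auto
    have "vector_functional (hat y) (hat z) \<in> normal_functionals"
      unfolding normal_functionals_def by (rule closure_span_base) auto
    then have "vector_functional (hat y) (hat z) - g \<in> normal_functionals"
      using g(1) by (rule subspace_diff[OF sub])
    moreover have "blinfun_apply (vector_functional (hat y) (hat z) - g) T
        = cinner ((T - P T) \<cdot> hat y) (hat z)" for T
      using am by (simp add: blinfun.diff_left g associated_map_def cinner_diff_left)
    ultimately show ?thesis by blast
  qed
  have sep: "T \<in> Har P" if 0: "\<And>y z. cinner ((T - P T) \<cdot> hat y) (hat z) = 0" for T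
  proof -
    have "P T \<cdot> hat y = T \<cdot> hat y" for y
    proof -
      let ?w = "(T - P T) \<cdot> hat y"
      have "closed {v. cinner v ?w = 0}"
        by (intro closed_Collect_eq continuous_on_const linear_continuous_on
            bounded_linear_intro[of _ "norm ?w"])
          (simp_all add: cinner_add_left scaleR_scaleC cinner_scaleC_left scaleC_complex_def
            cinner_Cauchy_Schwarz)
      moreover have "cinner (hat z) ?w = 0" for z
        using 0[of y z] cinner_commute[of "hat z" ?w] by simp
      ultimately have "closure (range hat) \<subseteq> {v. cinner v ?w = 0}"
        by (intro closure_minimal) auto
      then have "cinner ?w ?w = 0" using st by (auto simp: standard_representation_def)
      then have "?w = 0" by (simp only: cinner_norm) simp
      then show ?thesis by simp
    qed
    then have "P T = T" by (rule standard_representation_dense_eqI[OF st])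
    then show ?thesis by (simp add: Har_def)
  qed
  define G where "G = {g \<in> normal_functionals.
      \<exists>y z. \<forall>T. blinfun_apply g T = cinner ((T - P T) \<cdot> hat y) (hat z)}"
  have "Har P = {T. \<forall>g\<in>G. blinfun_apply g T = 0}"
  proof (intro equalityI subsetI)
    fix T assume "T \<in> Har P"
    then show "T \<in> {T. \<forall>g\<in>G. blinfun_apply g T = 0}" by (auto simp: Har_def G_def)
  next
    fix T assume T: "T \<in> {T. \<forall>g\<in>G. blinfun_apply g T = 0}"
    show "T \<in> Har P"
    proof (rule sep)
      fix y z
      obtain g where g: "g \<in> normal_functionals"
        "\<forall>T. blinfun_apply g T = cinner ((T - P T) \<cdot> hat y) (hat z)" using d by blast
      then have "g \<in> G" unfolding G_def by blast
      with T have "blinfun_apply g T = 0" by blast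
      then show "cinner ((T - P T) \<cdot> hat y) (hat z) = 0" using g(2) by (simp only:)
    qed
  qed
  moreover have "G \<subseteq> normal_functionals" by (auto simp: G_def)
  ultimately show ?thesis by blast
qed

theorem proposition2p7:
  fixes \<tau> :: "'m::cstar_algebra \<Rightarrow> complex"
    and hat :: "'m \<Rightarrow> 'h::complex_hilbert"
    and lm :: "'m \<Rightarrow> 'h bop"
    and \<phi> :: "'h bop \<Rightarrow> complex"
    and P :: "'h bop \<Rightarrow> 'h bop"
    and \<iota> :: "'m \<Rightarrow> 'b::cstar_algebra"
    and Q :: "'b \<Rightarrow> 'h bop"
  assumes "finite_von_neumann_algebra TYPE('m)"
    and "state \<tau>" and "normal \<tau>" and "faithful \<tau>" and "tracial \<tau>"
    and "standard_representation \<tau> hat lm"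
    and "hyperstate \<tau> lm \<phi>" and "associated_map hat lm \<phi> P"
    and "regular hat lm P" and "generating lm P"
    and "poisson_boundary lm P \<iota> Q"
  shows "commutant (range \<iota>) = \<iota> ` center \<and>
    (normal \<phi> \<and> von_neumann_factor TYPE('m) \<longrightarrow> von_neumann_factor TYPE('b))"
proof -
  note st = assms(6) and am = assms(8)
  have hom: "star_hom \<iota>" and inj: "inj \<iota>" and cp: "completely_positive Q"
    and iso: "\<And>b. norm (Q b) = norm b" and ran: "range Q = Har P" and Q\<iota>: "\<And>x. Q (\<iota> x) = lm x"
    using assms(11) by (auto simp: poisson_boundary_def)
  have \<iota>1: "\<iota> 1 = 1" and \<iota>m: "\<And>x y. \<iota> (x * y) = \<iota> x * \<iota> y" and \<iota>a: "\<And>x. \<iota> (x\<^sup>\<star>) = (\<iota> x)\<^sup>\<star>"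
    and \<iota>s: "\<And>c x. \<iota> (c *\<^sub>C x) = c *\<^sub>C \<iota> x"
    using hom by (simp_all add: star_hom_def clinear_def)
  have lin: "clinear Q" using cp by (simp add: completely_positive_def)
  have Q1: "Q 1 = 1" using Q\<iota>[of 1] by (simp add: \<iota>1 standard_representation_one[OF st])
  have lma: "(lm (x\<^sup>\<star>))\<^sup>\<star> = lm x" for x
    using completely_positive_adj[OF cp, of "\<iota> (x\<^sup>\<star>)"] by (simp add: \<iota>a[symmetric] adj_adj Q\<iota>)
  have Q_left: "Q (\<iota> x * b) = lm x * Q b" for x b
  proof -
    have "Q ((\<iota> (x\<^sup>\<star>))\<^sup>\<star> * b) = (Q (\<iota> (x\<^sup>\<star>)))\<^sup>\<star> * Q b"
    proof (rule multiplicative_domain[OF cp Q1])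
      show "Q ((\<iota> (x\<^sup>\<star>))\<^sup>\<star> * \<iota> (x\<^sup>\<star>)) = (Q (\<iota> (x\<^sup>\<star>)))\<^sup>\<star> * Q (\<iota> (x\<^sup>\<star>))"
        by (simp add: \<iota>a[symmetric] \<iota>m[symmetric] adj_adj Q\<iota> lma standard_representation_mult[OF st])
    qed
    then show ?thesis by (simp add: \<iota>a[symmetric] adj_adj Q\<iota> lma)
  qed
  have Q_right: "Q (b * \<iota> x) = Q b * lm x" for x b
  proof -
    \<comment> \<open>The right module property is the left one conjugated by the involution.\<close>
    have "(Q (\<iota> (x\<^sup>\<star>) * b\<^sup>\<star>))\<^sup>\<star> = (lm (x\<^sup>\<star>) * Q (b\<^sup>\<star>))\<^sup>\<star>" by (simp add: Q_left)
    then show ?thesis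
      by (simp add: completely_positive_adj[OF cp, symmetric] Q\<iota>[symmetric] adj_mult \<iota>a adj_adj)
  qed
  have Q_inj: "b = c" if "Q b = Q c" for b c
  proof -
    have "Q (b - c + c) = Q (b - c) + Q c" using lin unfolding clinear_def by blast
    then have "norm (b - c) = 0" using that iso[of "b - c"] by simp
    then show ?thesis by simp
  qed
  have gen: "star_subalgebra (range lm)"
    "\<And>A. star_subalgebra A \<Longrightarrow> A \<subseteq> Har P \<Longrightarrow> A \<subseteq> range lm"
    using assms(10) by (auto simp: generating_def)
  have trivial: "Har P \<inter> commutant (range lm) \<subseteq> range lm"
    by (rule gen(2)[OF star_subalgebra_Har_commutant[OF st am assms(9) gen(1)]]) simp
  have rel: "commutant (range \<iota>) = \<iota> ` center"
  proof (intro equalityI subsetI)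
    fix b assume b: "b \<in> commutant (range \<iota>)"
    then have comm: "b * \<iota> x = \<iota> x * b" for x by (simp add: commutant_def)
    have "Q b \<in> commutant (range lm)"
      using Q_left[of _ b] Q_right[of b] by (auto simp: commutant_def comm)
    then obtain z where "Q b = lm z" using trivial ran by blast
    then have bz: "b = \<iota> z" by (intro Q_inj) (simp add: Q\<iota>)
    have "z * x = x * z" for x
      using comm[of x] inj by (simp add: bz \<iota>m[symmetric] inj_eq)
    then show "b \<in> \<iota> ` center" unfolding bz by (simp add: commutant_def)
  next
    fix b assume "b \<in> \<iota> ` center"
    then show "b \<in> commutant (range \<iota>)"
      by (auto simp: commutant_def \<iota>m[symmetric])
  qed
  moreover have "von_neumann_factor TYPE('b)"
    if nrm: "normal \<phi>" and fac: "von_neumann_factor TYPE('m)"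
    unfolding von_neumann_factor_def
  proof (intro conjI equalityI subsetI)
    obtain G where "G \<subseteq> normal_functionals" "Har P = {T. \<forall>g\<in>G. blinfun_apply g T = 0}"
      using Har_annihilator[OF st am _ nrm] assms(7) by (auto simp: hyperstate_def)
    then show "von_neumann_algebra TYPE('b)"
      using ran by (intro von_neumann_algebra_of_weak_star_closed_range[OF lin iso]) simp_all
    fix b :: 'b
    show "b \<in> range (\<lambda>c. c *\<^sub>C 1)" if "b \<in> center"
    proof -
      have "b \<in> commutant (range \<iota>)" using that by (simp add: commutant_def)
      then obtain z where z: "z \<in> center" "b = \<iota> z" unfolding rel by blast
      then obtain c where "z = c *\<^sub>C 1" using fac by (auto simp: von_neumann_factor_def)
      then have "b = c *\<^sub>C 1" by (simp add: z \<iota>s \<iota>1)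
      then show ?thesis by blast
    qed
    show "b \<in> center" if "b \<in> range (\<lambda>c. c *\<^sub>C 1)"
      using that by (auto simp: commutant_def mult_scaleC_left mult_scaleC_right)
  qed
  ultimately show ?thesis by blast
qed

end
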